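(* Let $(K,v)$ be a valued field of finite rank and fix an extension $\overline v$ of $v$ to an algebraic closure $\overline K$ of $K$. Let $E=\{z_\nu\}_{\nu<\lambda}$ be a sequence in $(K,v)$ which is either a pseudo convergent sequence of algebraic type or a pseudo divergent sequence. Assume that $E$ is of one of the following types: (i) $E$ is a Cauchy sequence; (ii) $E$ is a pseudo convergent sequence of algebraic type with $\sup(E,\overline v)\in\overline v\overline K$; (iii) $E$ diverges to infinity; (iv) $E$ is a pseudo divergent sequence with $\inf(E,\overline v)\in\overline v\overline K$. Then $\mathrm{rk}\, v_EK(X)=\mathrm{rk}\, vK+1$. If $\mathrm{rk}\, vK=1$, then it is also necessary that $E$ is a Cauchy sequence, or a pseudo convergent sequence of algebraic type with $\sup(E,\overline v)\in\overline v\overline K$, or diverges to infinity, or is a pseudo divergent sequence with $\inf(E,\overline v)\in\overline v\overline K$, i.e. $\mathrm{rk}\, v_EK(X)=\mathrm{rk}\, vK+1$ implies that one of (i)–(iv) holds.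
   Context: Conventions. A valued field $(K,v)$ is a field with a (Krull) valuation, value group $vK$ (written additively). The rank $\mathrm{rk}\,\Gamma$ of an ordered abelian group $\Gamma$ is the order type of the set, ordered by inclusion, of its isolated subgroups, i.e. of the proper subgroups $\Delta$ such that $\alpha\in\Delta$, $\beta\in\Gamma$, $-\alpha\le\beta\le\alpha$ imply $\beta\in\Delta$. The rank of $(K,v)$ is $\mathrm{rk}\, vK$. Let $\lambda$ be a limit ordinal and $E=\{z_\nu\}_{\nu<\lambda}\subseteq K$. $E$ is pseudo convergent (pcs) if $v(z_{\nu_1}-z_{\nu_2})<v(z_{\nu_2}-z_{\nu_3})$ for all $\nu_1<\nu_2<\nu_3<\lambda$; then $\delta_\nu:=v(z_\nu-z_{\nu+1})$. A pcs $E$ is of algebraic type if $\{vf(z_\nu)\}_{\nu<\lambda}$ is not ultimately constant for some $f\in K[X]$, and it is a Cauchy sequence if $\{\delta_\nu\}$ is cofinal in $vK$. $E$ is pseudo divergent (pds) if $v(z_{\nu_1}-z_{\nu_2})>v(z_{\nu_2}-z_{\nu_3})$ for all $\nu_1<\nu_2<\nu_3<\lambda$; then $\delta_\nu:=v(z_\nu-z_\mu)$ for any $\mu<\nu$ (independent of $\mu$; $\nu\ge1$). A pds $E$ diverges to infinity if $\{\delta_\nu\}$ is coinitial in $vK$. $v_E$ is the valuation of $K(X)$ with valuation ring $\{\phi\in K(X)\mid v\phi(z_\nu)\ge 0$ for all sufficiently large $\nu\}$ (maximal ideal given by $v\phi(z_\nu)>0$ for all sufficiently large $\nu$); it extends $v$,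 and $v_EK(X)$ is its value group. Supremum and infimum. Let $\mathrm{rk}\, vK=n$ be a positive integer. Then $\overline v\overline K$ is order isomorphic to, and is identified with, $(\Gamma_1\oplus\dots\oplus\Gamma_n)_{\mathrm{lex}}$ for subgroups $\Gamma_i$ of $\mathbb R$; write $\delta_\nu=(\delta_{1,\nu},\dots,\delta_{n,\nu})$. Let $\tilde{\mathbb R}=\{-\infty\}\cup\mathbb R\cup\{\infty\}$ with its usual order. The set $\tilde{\mathbb R}^n$ with the lexicographic order is a complete totally ordered set, and $\sup(E,\overline v)$, $\inf(E,\overline v)$ denote the supremum and the infimum of $\{(\delta_{1,\nu},\dots,\delta_{n,\nu})\}_{\nu<\lambda}$ in it. *)

theory Defs
  imports
    "HOL-Algebra.Algebraic_Closure_Type"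
    "HOL-Algebra.Lattice"
    "HOL-Library.Extended"
    "HOL-Library.Extended_Real"
    "HOL-Library.FuncSet"
    "HOL-Library.Fun_Lexorder"
begin

section \<open>Valuations and value groups\<close>

text \<open>
  Krull valuations are written additively, with \<open>v 0 = Pinf\<close>. They need not map onto \<open>'g\<close>;
  \<open>Minf\<close> only exists because of the type and is never a value.
\<close>

definition krull_valuation :: "('k::field \<Rightarrow> 'g::linordered_ab_group_add extended) \<Rightarrow> bool" where
  "krull_valuation v \<longleftrightarrow>
     (\<forall>x. v x = Pinf \<longleftrightarrow> x = 0) \<and> (\<forall>x. v x \<noteq> Minf) \<and>
     (\<forall>x y. v (x * y) = v x + v y) \<and>
     (\<forall>x y. min (v x) (v y) \<le> v (x + y))"

definition value_group :: "('k::field \<Rightarrow> 'g::linordered_ab_group_add extended) \<Rightarrow> 'g set" where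
  "value_group v = {\<gamma>. \<exists>x. v x = Fin \<gamma>}"

definition valuation_ring :: "('k::field \<Rightarrow> 'g::linordered_ab_group_add extended) \<Rightarrow> 'k set" where
  "valuation_ring v = {x. 0 \<le> v x}"

section \<open>Rank\<close>

definition add_subgroup :: "'g::ab_group_add set \<Rightarrow> bool" where
  "add_subgroup H \<longleftrightarrow> 0 \<in> H \<and> (\<forall>\<alpha>\<in>H. \<forall>\<beta>\<in>H. \<alpha> + \<beta> \<in> H) \<and> (\<forall>\<alpha>\<in>H. - \<alpha> \<in> H)"

definition isolated_subgroups :: "'g::linordered_ab_group_add set \<Rightarrow> 'g set set" where
  "isolated_subgroups \<Gamma> =
     {\<Delta>. add_subgroup \<Delta> \<and> \<Delta> \<subset> \<Gamma> \<and>
         (\<forall>\<alpha>\<in>\<Delta>. \<forall>\<beta>\<in>\<Gamma>. - \<alpha> \<le> \<beta> \<and> \<beta> \<le> \<alpha> \<longrightarrow> \<beta> \<in> \<Delta>)}"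

text \<open>The isolated subgroups, ordered by inclusion, have the finite order type \<open>n\<close>.\<close>

definition has_rank :: "'g::linordered_ab_group_add set \<Rightarrow> nat \<Rightarrow> bool" where
  "has_rank \<Gamma> n \<longleftrightarrow>
     (\<exists>f. bij_betw f {..<n} (isolated_subgroups \<Gamma>) \<and>
          (\<forall>i<n. \<forall>j<n. i \<le> j \<longleftrightarrow> f i \<subseteq> f j))"

section \<open>Pseudo convergent and pseudo divergent sequences\<close>

text \<open>
  The index set, a limit ordinal, is a type of class \<open>{wellorder, no_top}\<close>; ``for all sufficiently
  large \<open>\<nu>\<close>'' is \<open>\<forall>\<^sub>F \<nu> in at_top\<close>.
\<close>

definition succ_idx :: "'i::{wellorder,no_top} \<Rightarrow> 'i" where
  "succ_idx \<nu> = (LEAST \<mu>. \<nu> < \<mu>)"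

definition pseudo_convergent ::
  "('k::field \<Rightarrow> 'g::linordered_ab_group_add extended) \<Rightarrow> ('i::{wellorder,no_top} \<Rightarrow> 'k) \<Rightarrow> bool" where
  "pseudo_convergent v z \<longleftrightarrow>
     (\<forall>\<nu>1 \<nu>2 \<nu>3. \<nu>1 < \<nu>2 \<and> \<nu>2 < \<nu>3 \<longrightarrow> v (z \<nu>1 - z \<nu>2) < v (z \<nu>2 - z \<nu>3))"

definition pcs_gauge ::
  "('k::field \<Rightarrow> 'g::linordered_ab_group_add extended) \<Rightarrow> ('i::{wellorder,no_top} \<Rightarrow> 'k) \<Rightarrow> 'g set" where
  "pcs_gauge v z = {\<delta>. \<exists>\<nu>. Fin \<delta> = v (z \<nu> - z (succ_idx \<nu>))}"

definition algebraic_type ::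
  "('k::field \<Rightarrow> 'g::linordered_ab_group_add extended) \<Rightarrow> ('i::{wellorder,no_top} \<Rightarrow> 'k) \<Rightarrow> bool" where
  "algebraic_type v z \<longleftrightarrow>
     (\<exists>f::'k poly. \<not> (\<exists>c. \<forall>\<^sub>F \<nu> in at_top. v (poly f (z \<nu>)) = c))"

definition pcs_algebraic ::
  "('k::field \<Rightarrow> 'g::linordered_ab_group_add extended) \<Rightarrow> ('i::{wellorder,no_top} \<Rightarrow> 'k) \<Rightarrow> bool" where
  "pcs_algebraic v z \<longleftrightarrow> pseudo_convergent v z \<and> algebraic_type v z"

definition cauchy_pcs ::
  "('k::field \<Rightarrow> 'g::linordered_ab_group_add extended) \<Rightarrow> ('i::{wellorder,no_top} \<Rightarrow> 'k) \<Rightarrow> bool" where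
  "cauchy_pcs v z \<longleftrightarrow>
     pseudo_convergent v z \<and> (\<forall>\<gamma>\<in>value_group v. \<exists>\<delta>\<in>pcs_gauge v z. \<gamma> \<le> \<delta>)"

definition pseudo_divergent ::
  "('k::field \<Rightarrow> 'g::linordered_ab_group_add extended) \<Rightarrow> ('i::{wellorder,no_top} \<Rightarrow> 'k) \<Rightarrow> bool" where
  "pseudo_divergent v z \<longleftrightarrow>
     (\<forall>\<nu>1 \<nu>2 \<nu>3. \<nu>1 < \<nu>2 \<and> \<nu>2 < \<nu>3 \<longrightarrow> v (z \<nu>2 - z \<nu>3) < v (z \<nu>1 - z \<nu>2))"

text \<open>
  For a pseudo divergent sequence \<open>v (z \<nu> - z \<mu>)\<close> with \<open>\<mu> < \<nu>\<close> does not depend on \<open>\<mu>\<close>, so that the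
  following is the set of all \<open>\<delta>\<^sub>\<nu>\<close>, \<open>\<nu> \<ge> 1\<close>. The definition allows the first two terms to coincide;
  then \<open>\<delta>\<^sub>1 = \<infinity>\<close>, which is left out here: all later \<open>\<delta>\<^sub>\<nu>\<close> are finite, and \<open>\<infinity>\<close> matters neither for
  the infimum nor for coinitiality.
\<close>

definition pds_gauge ::
  "('k::field \<Rightarrow> 'g::linordered_ab_group_add extended) \<Rightarrow> ('i::{wellorder,no_top} \<Rightarrow> 'k) \<Rightarrow> 'g set" where
  "pds_gauge v z = {\<delta>. \<exists>\<nu> \<mu>. \<mu> < \<nu> \<and> Fin \<delta> = v (z \<nu> - z \<mu>)}"

definition diverges_to_infinity ::
  "('k::field \<Rightarrow> 'g::linordered_ab_group_add extended) \<Rightarrow> ('i::{wellorder,no_top} \<Rightarrow> 'k) \<Rightarrow> bool" where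
  "diverges_to_infinity v z \<longleftrightarrow>
     pseudo_divergent v z \<and> (\<forall>\<gamma>\<in>value_group v. \<exists>\<delta>\<in>pds_gauge v z. \<delta> \<le> \<gamma>)"

section \<open>The valuation of the rational function field attached to a sequence\<close>

text \<open>
  The poles of a representation \<open>p / q\<close> are avoided by all sufficiently large indices, as a pseudo
  convergent or pseudo divergent sequence takes each value at most twice; so the condition does not
  depend on the representation.
\<close>

definition seq_ring ::
  "('k::field \<Rightarrow> 'g::linordered_ab_group_add extended) \<Rightarrow> ('i::{wellorder,no_top} \<Rightarrow> 'k)
     \<Rightarrow> 'k poly fract set" where
  "seq_ring v z =
     {Fraction_Field.Fract p q | p q. q \<noteq> 0 \<and>
        (\<forall>\<^sub>F \<nu> in at_top. poly q (z \<nu>) \<noteq> 0 \<and> 0 \<le> v (poly p (z \<nu>) / poly q (z \<nu>)))}"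

text \<open>
  A valuation is determined by its valuation ring up to an order isomorphism of the value group;
  in particular the rank of the value group of \<open>w\<close> is the same for all \<open>w\<close> as below.
\<close>

definition is_seq_valuation ::
  "('k::field \<Rightarrow> 'g::linordered_ab_group_add extended) \<Rightarrow> ('i::{wellorder,no_top} \<Rightarrow> 'k)
     \<Rightarrow> ('k poly fract \<Rightarrow> 'h::linordered_ab_group_add extended) \<Rightarrow> bool" where
  "is_seq_valuation v z w \<longleftrightarrow> krull_valuation w \<and> valuation_ring w = seq_ring v z"

section \<open>Lexicographic products, supremum and infimum\<close>

text \<open>
  An isomorphism \<open>\<iota>\<close> of ordered groups from \<open>G\<close> onto the lexicographic sum of the subgroups
  \<open>\<Gamma> 0, \<dots>, \<Gamma> (n - 1)\<close> of the reals; the component with the smallest index dominates.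
\<close>

definition lex_identification ::
  "'g::linordered_ab_group_add set \<Rightarrow> nat \<Rightarrow> (nat \<Rightarrow> real set) \<Rightarrow> ('g \<Rightarrow> nat \<Rightarrow> real) \<Rightarrow> bool" where
  "lex_identification G n \<Gamma> \<iota> \<longleftrightarrow>
     (\<forall>i<n. add_subgroup (\<Gamma> i)) \<and>
     bij_betw \<iota> G (\<Pi>\<^sub>E i\<in>{..<n}. \<Gamma> i) \<and>
     (\<forall>\<alpha>\<in>G. \<forall>\<beta>\<in>G. (\<forall>i<n. \<iota> (\<alpha> + \<beta>) i = \<iota> \<alpha> i + \<iota> \<beta> i) \<and>
                  (\<alpha> < \<beta> \<longleftrightarrow> less_fun (\<iota> \<alpha>) (\<iota> \<beta>)))"

definition lex_cube :: "nat \<Rightarrow> (nat \<Rightarrow> ereal) gorder" where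
  "lex_cube n = \<lparr>carrier = {..<n} \<rightarrow>\<^sub>E UNIV, eq = (=), le = (\<lambda>x y. x = y \<or> less_fun x y)\<rparr>"

definition lex_point :: "nat \<Rightarrow> ('g \<Rightarrow> nat \<Rightarrow> real) \<Rightarrow> 'g \<Rightarrow> nat \<Rightarrow> ereal" where
  "lex_point n \<iota> \<gamma> = (\<lambda>i\<in>{..<n}. ereal (\<iota> \<gamma> i))"

definition gauge_sup :: "nat \<Rightarrow> ('g \<Rightarrow> nat \<Rightarrow> real) \<Rightarrow> 'g set \<Rightarrow> nat \<Rightarrow> ereal" where
  "gauge_sup n \<iota> D = \<Squnion>\<^bsub>lex_cube n\<^esub> (lex_point n \<iota> ` D)"

definition gauge_inf :: "nat \<Rightarrow> ('g \<Rightarrow> nat \<Rightarrow> real) \<Rightarrow> 'g set \<Rightarrow> nat \<Rightarrow> ereal" where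
  "gauge_inf n \<iota> D = \<Sqinter>\<^bsub>lex_cube n\<^esub> (lex_point n \<iota> ` D)"

text \<open>
  The four types of sequences. \<open>G\<close> is the value group of the extension of \<open>v\<close> to the algebraic
  closure, identified by \<open>\<iota>\<close> with a lexicographic sum of \<open>n\<close> subgroups of the reals.
\<close>

definition rank_jump_type ::
  "('k::field \<Rightarrow> 'g::linordered_ab_group_add extended) \<Rightarrow> 'g set \<Rightarrow> nat \<Rightarrow> ('g \<Rightarrow> nat \<Rightarrow> real)
     \<Rightarrow> ('i::{wellorder,no_top} \<Rightarrow> 'k) \<Rightarrow> bool" where
  "rank_jump_type v G n \<iota> z \<longleftrightarrow>
     cauchy_pcs v z \<or>
     pcs_algebraic v z \<and> gauge_sup n \<iota> (pcs_gauge v z) \<in> lex_point n \<iota> ` G \<or>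
     diverges_to_infinity v z \<or>
     pseudo_divergent v z \<and> gauge_inf n \<iota> (pds_gauge v z) \<in> lex_point n \<iota> ` G"

end

theory Submission
  imports Defs
begin

text \<open>
  For every \<open>a\<close> in the algebraic closure, the value of \<open>z \<nu> - a\<close> is eventually constant or eventually
  \<open>\<delta>\<^sub>\<nu>\<close>. Factoring numerator and denominator, the value of \<open>\<phi> (z \<nu>)\<close> is eventually \<open>m \<delta>\<^sub>\<nu> + \<gamma>\<close> with
  \<open>m\<close> an integer and \<open>\<gamma>\<close> in the value group \<open>G\<close> of the closure, so that the value group of \<open>v\<^sub>E\<close> consists
  of germs of such functions, has relative rational rank at most 1 over \<open>vK\<close>, and \<open>G\<close> is torsion over
  \<open>vK\<close>. Hence contraction of convex subgroups from \<open>v\<^sub>E K(X)\<close> to \<open>vK\<close> is onto and identifies at most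
  one pair, and the rank goes up by one as soon as it identifies some pair. Of the types (i) to (iv),
  (i) and (iii) produce an element of \<open>v\<^sub>E K(X)\<close> that is infinitely large over \<open>vK\<close>; in (ii) and (iv),
  with \<open>\<gamma>\<^sub>0\<close> the supremum or infimum, a multiple of \<open>\<delta> - \<gamma>\<^sub>0\<close> is infinitely small over \<open>vK\<close>. In rank one, if
  none of the types occurs, then \<open>\<delta>\<^sub>\<nu>\<close> tends to a real number outside of the divisible group \<open>G\<close>; so
  every nonzero germ has a nonzero limit and the group of germs is archimedean.
\<close>

section \<open>Integer multiples in abelian groups\<close>

text \<open>The valuation \<open>vE\<close> takes values in an ordered group of its own and is known
  only through its ring; not even an embedding of the value group of K is given. Everything is read
  off one equivalence: a value is nonnegative iff its germ is eventually nonnegative. With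
  additivity this yields order, equality and the embedding by constant germs. That contraction
  merges at most one pair is a relation argument: elements x and y taken from two different jumps
  satisfy some nontrivial a x + b y in vK, and purity of convex subgroups forces first b = 0, then a
  = 0. The constants \<open>\<gamma>\<close> and \<open>\<gamma>0\<close> occurring in germs lie
  only in G. Torsion supplies a multiple that moves them into vK, and divisibility cuts an element
  of vK into arbitrarily many equal parts inside G; this is how the gap to \<open>\<gamma>0\<close>
  is seen to be smaller than every fraction of every positive element of vK. Taking the negative of
  the gauge in the pseudo divergent case makes \<open>\<epsilon>\<close> increasing in both cases,
  so that (i) and (iii) become one lemma, and (ii) and (iv) another.\<close>

definition imul :: "int \<Rightarrow> 'a::ab_group_add \<Rightarrow> 'a" where
  "imul k x = (\<Sum>i<nat k. x) - (\<Sum>i<nat (- k). x)"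

lemma sum_lessThan_const_add:
  "(\<Sum>i<m + n. x) = (\<Sum>i<m. x) + (\<Sum>i<n. x :: 'a::comm_monoid_add)" for m n :: nat
  by (induction n) (simp_all add: ac_simps)

text \<open>Any representation of the multiplier as a difference of naturals may be used; this makes
  additivity in the multiplier free of sign cases.\<close>

lemma imul_diff_int: "imul (int m - int n) x = (\<Sum>i<m. x) - (\<Sum>i<n. x)"
proof (cases "n \<le> m")
  case True
  then obtain d where "m = n + d" using le_Suc_ex by blast
  then show ?thesis by (simp add: imul_def sum_lessThan_const_add)
next
  case False
  then obtain d where "n = m + d" using le_Suc_ex nat_le_linear by blast
  then show ?thesis by (simp add: imul_def sum_lessThan_const_add)
qed

lemma imul_1 [simp]: "imul 1 x = x"
  by (simp add: imul_def)

lemma imul_add_left: "imul (a + b) x = imul a x + imul b x"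
proof -
  obtain m n where a: "a = int m - int n" by (rule int_diff_cases)
  obtain m' n' where b: "b = int m' - int n'" by (rule int_diff_cases)
  have "a + b = int (m + m') - int (n + n')" using a b by simp
  then show ?thesis unfolding a b
    by (simp only: imul_diff_int sum_lessThan_const_add) (simp add: a b imul_diff_int algebra_simps)
qed

lemma imul_add_right: "imul a (x + y) = imul a x + imul a y"
  by (simp add: imul_def sum.distrib)

lemma imul_0 [simp]: "imul 0 x = 0" "imul a 0 = 0"
  by (simp_all add: imul_def)

lemma imul_uminus_left: "imul (- a) x = - imul a x"
  using imul_add_left[of "-a" a x] by (simp add: eq_neg_iff_add_eq_0)

lemma imul_uminus_right: "imul a (- x) = - imul a x"
  using imul_add_right[of a "-x" x] by (simp add: eq_neg_iff_add_eq_0)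

lemma imul_assoc: "imul a (imul b x) = imul (a * b) x"
proof (induction a rule: int_induct[where k = 0])
  case (step1 i)
  then show ?case by (simp add: imul_add_left distrib_right)
next
  case (step2 i)
  then show ?case
    using imul_add_left[of "i - 1" 1 "imul b x"] imul_add_left[of "(i - 1) * b" b x]
    by (simp add: algebra_simps)
qed simp

interpretation imul: Modules.module imul
  by unfold_locales (simp_all add: imul_add_left imul_add_right imul_assoc)

lemma imul_Suc: "imul (int (Suc n)) x = imul (int n) x + x"
  using imul_add_left[of "int n" 1 x] by (simp add: add.commute)

lemma imul_pos:
  fixes x :: "'a::linordered_ab_group_add"
  assumes "0 < k" "0 < x"
  shows "0 < imul k x"
  using assms(1)
proof (induction k rule: int_gr_induct)
  case base
  then show ?case using assms by simp
next
  case (step i)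
  then show ?case using assms by (simp add: imul_add_left add_pos_pos)
qed

lemma imul_less_iff:
  fixes x y :: "'a::linordered_ab_group_add"
  assumes "0 < k"
  shows "imul k x < imul k y \<longleftrightarrow> x < y"
proof -
  have *: "imul k x < imul k y" if "x < y" for x y :: 'a
    using imul_pos[OF assms, of "y - x"] that by (simp add: imul.scale_right_diff_distrib)
  then show ?thesis using *[of y x] by (metis less_asym' neqE)
qed

lemma imul_eq_0_iff:
  fixes x :: "'a::linordered_ab_group_add"
  shows "imul k x = 0 \<longleftrightarrow> k = 0 \<or> x = 0"
proof -
  have *: "imul k x \<noteq> 0" if "0 < k" "x \<noteq> 0" for k
    using imul_less_iff[OF that(1), of x 0] imul_less_iff[OF that(1), of 0 x] that(2)
    by (auto simp: neq_iff)
  show ?thesis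
    using *[of k] *[of "-k"] by (cases k "0::int" rule: linorder_cases) (auto simp: imul_uminus_left)
qed

lemma le_imul:
  fixes x :: "'a::linordered_ab_group_add"
  assumes "0 < k" "0 \<le> x"
  shows "x \<le> imul k x"
  using assms(1)
proof (induction k rule: int_gr_induct)
  case (step i)
  then show ?case using assms(2) by (simp add: imul_add_left add_increasing2)
qed simp

section \<open>Absolute values in ordered groups\<close>

definition mag :: "'a::linordered_ab_group_add \<Rightarrow> 'a" where
  "mag x = max x (- x)"

lemma mag_le_iff: "mag x \<le> y \<longleftrightarrow> - y \<le> x \<and> x \<le> y"
  by (auto simp: mag_def minus_le_iff)

lemma mag_cases: "mag x = x \<or> mag x = - x"
  by (auto simp: mag_def max_def)

lemma le_mag: "x \<le> mag x"
  by (simp add: mag_def)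

lemma mag_nonneg: "0 \<le> mag x"
  by (simp add: mag_def le_max_iff_disj linear)

lemma mag_eq_0_iff: "mag x = 0 \<longleftrightarrow> x = 0"
  using mag_cases[of x] by (auto simp: mag_def)

lemma mag_0 [simp]: "mag 0 = 0"
  by (simp add: mag_def)

lemma mag_uminus [simp]: "mag (- x) = mag x"
  by (simp add: mag_def max.commute)

lemma mag_triangle: "mag x \<le> s \<Longrightarrow> mag y \<le> t \<Longrightarrow> mag (x + y) \<le> s + t"
  using add_mono[of x s y t] add_mono[of "- s" x "- t" y] by (simp add: mag_le_iff)

lemma add_subgroup_imul:
  assumes "add_subgroup H" "x \<in> H"
  shows "imul k x \<in> H"
proof (induction k rule: int_induct[where k = 0])
  case base
  then show ?case using assms by (simp add: add_subgroup_def)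
next
  case (step1 i)
  then show ?case using assms by (simp add: imul_add_left add_subgroup_def)
next
  case (step2 i)
  have "imul (i - 1) x = imul i x + - x"
    using imul_add_left[of "i - 1" 1 x] by simp
  then show ?case using assms step2 by (metis add_subgroup_def)
qed

section \<open>Convex subgroups and rank\<close>

definition convex_subgroups :: "'g::linordered_ab_group_add set \<Rightarrow> 'g set set" where
  "convex_subgroups \<Gamma> =
     {\<Delta>. add_subgroup \<Delta> \<and> \<Delta> \<subseteq> \<Gamma> \<and> (\<forall>\<alpha>\<in>\<Delta>. \<forall>\<beta>\<in>\<Gamma>. - \<alpha> \<le> \<beta> \<and> \<beta> \<le> \<alpha> \<longrightarrow> \<beta> \<in> \<Delta>)}"

lemma isolated_subgroups_eq: "isolated_subgroups \<Gamma> = convex_subgroups \<Gamma> - {\<Gamma>}"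
  by (auto simp: isolated_subgroups_def convex_subgroups_def)

lemma convex_subgroups_self: "add_subgroup \<Gamma> \<Longrightarrow> \<Gamma> \<in> convex_subgroups \<Gamma>"
  by (auto simp: convex_subgroups_def)

lemma convex_subgroups_D:
  assumes "C \<in> convex_subgroups \<Gamma>"
  shows "add_subgroup C" "C \<subseteq> \<Gamma>" "0 \<in> C"
    "\<And>x y. x \<in> C \<Longrightarrow> y \<in> C \<Longrightarrow> x + y \<in> C"
    "\<And>x. x \<in> C \<Longrightarrow> - x \<in> C"
    "\<And>x k. x \<in> C \<Longrightarrow> imul k x \<in> C"
    "\<And>x y. x \<in> C \<Longrightarrow> y \<in> \<Gamma> \<Longrightarrow> mag y \<le> mag x \<Longrightarrow> y \<in> C"
proof -
  show C: "add_subgroup C" "C \<subseteq> \<Gamma>" "0 \<in> C"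
    "\<And>x y. x \<in> C \<Longrightarrow> y \<in> C \<Longrightarrow> x + y \<in> C"
    "\<And>x. x \<in> C \<Longrightarrow> - x \<in> C"
    using assms by (auto simp: convex_subgroups_def add_subgroup_def)
  show "\<And>x k. x \<in> C \<Longrightarrow> imul k x \<in> C" using add_subgroup_imul[OF C(1)] .
  show "y \<in> C" if "x \<in> C" "y \<in> \<Gamma>" "mag y \<le> mag x" for x y
  proof -
    have "mag x \<in> C" using C(5) that(1) mag_cases[of x] by auto
    moreover have "- mag x \<le> y" "y \<le> mag x" using that(3) by (auto simp: mag_le_iff)
    ultimately show ?thesis using assms that(2) by (auto simp: convex_subgroups_def)
  qed
qed

text \<open>Purity: for nonzero k the absolute value of x is at most that of k x, so convexity pulls
  x into C.\<close>

lemma convex_subgroups_imul_D: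
  assumes C: "C \<in> convex_subgroups \<Gamma>" and "imul k x \<in> C" "k \<noteq> 0" "x \<in> \<Gamma>"
  shows "x \<in> C"
proof -
  have *: "mag x \<le> imul \<bar>k\<bar> (mag x)" using assms by (intro le_imul mag_nonneg) auto
  have "imul \<bar>k\<bar> (mag x) \<in> C"
    using assms(2) convex_subgroups_D(5)[OF C]
    using mag_cases[of x] by (cases "k \<ge> 0") (auto simp: imul_uminus_left imul_uminus_right)
  moreover have "mag x \<le> mag (imul \<bar>k\<bar> (mag x))" using order_trans[OF * le_mag] .
  ultimately show ?thesis using convex_subgroups_D(7)[OF C _ assms(4)] by blast
qed

text \<open>Of two witnesses against both inclusions, the one of smaller absolute value would lie in
  the other subgroup as well.\<close>

lemma convex_subgroups_chain:
  assumes "A \<in> convex_subgroups \<Gamma>" "B \<in> convex_subgroups \<Gamma>"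
  shows "A \<subseteq> B \<or> B \<subseteq> A"
proof (rule ccontr)
  assume "\<not> ?thesis"
  then obtain a b where "a \<in> A" "a \<notin> B" "b \<in> B" "b \<notin> A" by blast
  then show False
    using convex_subgroups_D(7)[OF assms(1), of a b] convex_subgroups_D(7)[OF assms(2), of b a]
      convex_subgroups_D(2)[OF assms(1)] convex_subgroups_D(2)[OF assms(2)]
    by (meson linear subsetD)
qed

text \<open>For a subgroup S of \<open>\<Gamma>\<close> this is the smallest convex subgroup of
  \<open>\<Gamma>\<close> containing S. The bound can be s itself in place of \<open>mag s\<close>,
  since the condition forces s to be nonnegative.\<close>

definition convex_hull_in :: "'g::linordered_ab_group_add set \<Rightarrow> 'g set \<Rightarrow> 'g set" where
  "convex_hull_in \<Gamma> S = {x\<in>\<Gamma>. \<exists>s\<in>S. mag x \<le> s}"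

lemma convex_hull_in_convex_subgroup:
  assumes "add_subgroup \<Gamma>" "add_subgroup S"
  shows "convex_hull_in \<Gamma> S \<in> convex_subgroups \<Gamma>"
proof -
  have "x + y \<in> convex_hull_in \<Gamma> S" if "x \<in> convex_hull_in \<Gamma> S" "y \<in> convex_hull_in \<Gamma> S" for x y
  proof -
    from that obtain s t where "s \<in> S" "t \<in> S" "mag x \<le> s" "mag y \<le> t" "x \<in> \<Gamma>" "y \<in> \<Gamma>"
      by (auto simp: convex_hull_in_def)
    moreover then have "mag (x + y) \<le> s + t" by (simp add: mag_triangle)
    ultimately show ?thesis
      using assms by (auto simp: convex_hull_in_def add_subgroup_def intro!: bexI[of _ "s + t"])
  qed
  moreover have "\<beta> \<in> convex_hull_in \<Gamma> S"
    if "\<alpha> \<in> convex_hull_in \<Gamma> S" "\<beta> \<in> \<Gamma>" "- \<alpha> \<le> \<beta>" "\<beta> \<le> \<alpha>" for \<alpha> \<beta>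
  proof -
    from that obtain s where s: "s \<in> S" "mag \<alpha> \<le> s" by (auto simp: convex_hull_in_def)
    have "mag \<beta> \<le> \<alpha>" using that(3,4) by (simp only: mag_le_iff)
    then have "mag \<beta> \<le> s" by (rule order_trans[OF _ order_trans[OF le_mag s(2)]])
    then show ?thesis using s(1) that(2) by (auto simp: convex_hull_in_def)
  qed
  moreover have "- x \<in> convex_hull_in \<Gamma> S" if "x \<in> convex_hull_in \<Gamma> S" for x
    using that assms(1) by (auto simp: convex_hull_in_def add_subgroup_def)
  moreover have "0 \<in> convex_hull_in \<Gamma> S"
    using assms by (auto simp: convex_hull_in_def add_subgroup_def)
  moreover have "convex_hull_in \<Gamma> S \<subseteq> \<Gamma>" by (auto simp: convex_hull_in_def)
  ultimately show ?thesis by (auto simp: convex_subgroups_def add_subgroup_def)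
qed

text \<open>On a chain, the number of proper predecessors is strictly monotone with values below the
  cardinality; its inverse is the enumeration.\<close>

lemma finite_chain_enumeration:
  assumes "finite S" and chain: "\<And>A B. A \<in> S \<Longrightarrow> B \<in> S \<Longrightarrow> A \<subseteq> B \<or> B \<subseteq> A"
  shows "\<exists>f. bij_betw f {..<card S} S \<and> (\<forall>i<card S. \<forall>j<card S. i \<le> j \<longleftrightarrow> f i \<subseteq> f j)"
proof -
  define r where "r A = card {B\<in>S. B \<subset> A}" for A
  have fin: "finite {B\<in>S. B \<subset> A}" for A using assms(1) by simp
  have less: "r A < r B" if "A \<in> S" "B \<in> S" "A \<subset> B" for A B
    unfolding r_def using that by (intro psubset_card_mono fin) auto
  have "r A < card S" if "A \<in> S" for A
    unfolding r_def using that by (intro psubset_card_mono assms(1)) auto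
  moreover have inj: "inj_on r S"
    by (rule inj_onI) (metis chain less less_irrefl psubsetI)
  ultimately have "r ` S = {..<card S}"
    by (intro card_subset_eq) (auto simp: card_image)
  then have "bij_betw r S {..<card S}" using inj by (simp add: bij_betw_def)
  then obtain f where f: "bij_betw f {..<card S} S" and rf: "\<And>i. i < card S \<Longrightarrow> r (f i) = i"
    by (metis bij_betw_inv_into bij_betw_inv_into_right lessThan_iff)
  have fS: "f i \<in> S" if "i < card S" for i using f that by (auto simp: bij_betw_def)
  have "i \<le> j \<longleftrightarrow> f i \<subseteq> f j" if "i < card S" "j < card S" for i j
    using less[OF fS fS] chain[OF fS fS] rf that
    by (metis leD le_less_linear order_le_imp_less_or_eq less_imp_le psubsetI subset_refl)
  then show ?thesis using f by blast
qed

text \<open>The order type of a finite chain is its cardinality; the additional 1 accounts for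
  \<open>\<Gamma>\<close> itself.\<close>

lemma has_rank_iff:
  assumes "add_subgroup \<Gamma>"
  shows "has_rank \<Gamma> n \<longleftrightarrow> finite (convex_subgroups \<Gamma>) \<and> card (convex_subgroups \<Gamma>) = n + 1"
proof -
  have ins: "convex_subgroups \<Gamma> = insert \<Gamma> (isolated_subgroups \<Gamma>)" "\<Gamma> \<notin> isolated_subgroups \<Gamma>"
    using convex_subgroups_self[OF assms] by (auto simp: isolated_subgroups_eq)
  have "has_rank \<Gamma> n \<longleftrightarrow> finite (isolated_subgroups \<Gamma>) \<and> card (isolated_subgroups \<Gamma>) = n"
  proof
    assume "has_rank \<Gamma> n"
    then obtain f where "bij_betw f {..<n} (isolated_subgroups \<Gamma>)" by (auto simp: has_rank_def)
    then show "finite (isolated_subgroups \<Gamma>) \<and> card (isolated_subgroups \<Gamma>) = n"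
      using bij_betw_finite bij_betw_same_card by fastforce
  next
    assume *: "finite (isolated_subgroups \<Gamma>) \<and> card (isolated_subgroups \<Gamma>) = n"
    show "has_rank \<Gamma> n"
      using finite_chain_enumeration[of "isolated_subgroups \<Gamma>"] * convex_subgroups_chain[of _ \<Gamma>]
      unfolding has_rank_def isolated_subgroups_eq by blast
  qed
  then show ?thesis using ins by (metis Suc_eq_plus1 card_insert_disjoint finite_insert Suc_inject)
qed

text \<open>
  In an extension \<open>j : V \<rightarrow> W\<close> of relative rational rank at most 1, the map \<open>C \<mapsto> j\<^sup>-\<^sup>1 C\<close> on convex
  subgroups identifies at most one pair.
\<close>

locale group_extension =
  fixes V :: "'g::linordered_ab_group_add set" and W :: "'h::linordered_ab_group_add set"
    and j :: "'g \<Rightarrow> 'h"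
  assumes V: "add_subgroup V" and W: "add_subgroup W"
    and j_in: "\<And>x. x \<in> V \<Longrightarrow> j x \<in> W"
    and j_add: "\<And>x y. x \<in> V \<Longrightarrow> y \<in> V \<Longrightarrow> j (x + y) = j x + j y"
    and j_le: "\<And>x y. x \<in> V \<Longrightarrow> y \<in> V \<Longrightarrow> j x \<le> j y \<longleftrightarrow> x \<le> y"
    and rel_rank: "\<And>x y. x \<in> W \<Longrightarrow> y \<in> W \<Longrightarrow>
      \<exists>a b \<gamma>. (a \<noteq> 0 \<or> b \<noteq> 0) \<and> \<gamma> \<in> V \<and> imul a x + imul b y = j \<gamma>"
begin

lemma j_0 [simp]: "j 0 = 0"
  using j_add[of 0 0] V by (simp add: add_subgroup_def)

lemma j_uminus: "x \<in> V \<Longrightarrow> j (- x) = - j x"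
  using j_add[of "- x" x] V by (simp add: add_subgroup_def eq_neg_iff_add_eq_0)

lemma j_mag: "x \<in> V \<Longrightarrow> j (mag x) = mag (j x)"
  using j_le[of x "- x"] V j_uminus[of x] by (auto simp: mag_def max_def add_subgroup_def)

lemma j_less: "x \<in> V \<Longrightarrow> y \<in> V \<Longrightarrow> j x < j y \<longleftrightarrow> x < y"
  using j_le[of y x] by (simp add: not_le[symmetric])

lemma V_mag: "x \<in> V \<Longrightarrow> mag x \<in> V"
  using V mag_cases[of x] by (auto simp: add_subgroup_def)

lemma image_add_subgroup:
  assumes "add_subgroup D" "D \<subseteq> V"
  shows "add_subgroup (j ` D)"
proof -
  have "j x + j y \<in> j ` D" if "x \<in> D" "y \<in> D" for x y
    using that assms j_add[of x y] by (metis add_subgroup_def imageI subsetD)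
  moreover have "- j x \<in> j ` D" if "x \<in> D" for x
    using that assms j_uminus[of x] by (metis add_subgroup_def imageI subsetD)
  moreover have "0 \<in> j ` D" using assms(1) j_0 by (metis add_subgroup_def imageI)
  ultimately show ?thesis by (auto simp: add_subgroup_def)
qed

definition contraction :: "'h set \<Rightarrow> 'g set" where
  "contraction C = {\<gamma>\<in>V. j \<gamma> \<in> C}"

lemma contraction_convex_subgroup:
  assumes "C \<in> convex_subgroups W"
  shows "contraction C \<in> convex_subgroups V"
proof -
  have "\<beta> \<in> contraction C"
    if "\<alpha> \<in> contraction C" "\<beta> \<in> V" "- \<alpha> \<le> \<beta>" "\<beta> \<le> \<alpha>" for \<alpha> \<beta>
  proof -
    have \<alpha>: "\<alpha> \<in> V" "j \<alpha> \<in> C" using that(1) by (auto simp: contraction_def)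
    have "- j \<alpha> \<le> j \<beta>" "j \<beta> \<le> j \<alpha>"
      using j_le[of "- \<alpha>" \<beta>] j_le[of \<beta> \<alpha>] that \<alpha> j_uminus[of \<alpha>] V by (auto simp: add_subgroup_def)
    then show ?thesis
      using assms \<alpha>(2) j_in[OF that(2)] that(2) by (auto simp: convex_subgroups_def contraction_def)
  qed
  moreover have "add_subgroup (contraction C)"
    using V convex_subgroups_D(3-5)[OF assms] unfolding add_subgroup_def contraction_def
    by (simp add: j_add j_uminus)
  ultimately show ?thesis unfolding convex_subgroups_def by (auto simp: contraction_def)
qed

text \<open>Surjectivity of contraction: a bound on \<open>j \<gamma>\<close> by an element
  \<open>j d\<close> of the image reflects along j to a bound on \<open>\<gamma>\<close> by d, so
  convexity of D lets nothing new in.\<close>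

lemma contraction_hull:
  assumes "D \<in> convex_subgroups V"
  shows "contraction (convex_hull_in W (j ` D)) = D"
proof -
  note D = convex_subgroups_D[OF assms]
  have "\<gamma> \<in> D" if "\<gamma> \<in> V" "d \<in> D" "mag (j \<gamma>) \<le> j d" for \<gamma> d
  proof -
    have "mag \<gamma> \<le> d" using that D(2) j_le[of "mag \<gamma>" d] by (auto simp: j_mag V_mag)
    then show ?thesis using D(7)[OF that(2,1)] order_trans[OF _ le_mag] by blast
  qed
  moreover have "\<exists>d\<in>D. mag (j \<gamma>) \<le> j d" if "\<gamma> \<in> D" for \<gamma>
    using that D(2,5) j_mag[of \<gamma>] mag_cases[of \<gamma>] by (intro bexI[of _ "mag \<gamma>"]) auto
  ultimately show ?thesis
    using D(2) j_in by (auto simp: contraction_def convex_hull_in_def)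
qed

lemma contraction_mono: "A \<subseteq> B \<Longrightarrow> contraction A \<subseteq> contraction B"
  by (auto simp: contraction_def)

lemma no_two_jumps:
  assumes "A \<in> convex_subgroups W" "B \<in> convex_subgroups W"
    "C \<in> convex_subgroups W" "D \<in> convex_subgroups W"
    and "A \<subset> B" "B \<subseteq> C" "C \<subset> D"
    and "contraction A = contraction B" "contraction C = contraction D"
  shows False
proof -
  from assms(5,7) obtain x y where xy: "x \<in> B" "x \<notin> A" "y \<in> D" "y \<notin> C" by blast
  then have W: "x \<in> W" "y \<in> W" "x \<in> C" "x \<in> D"
    using convex_subgroups_D(2)[OF assms(2)] convex_subgroups_D(2)[OF assms(4)] assms(6,7) by auto
  then obtain a b \<gamma> where ab: "a \<noteq> 0 \<or> b \<noteq> 0" "\<gamma> \<in> V" "imul a x + imul b y = j \<gamma>"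
    using rel_rank by blast
  \<comment> \<open>Elements of V cannot tell D from C, nor B from A. So the relation first puts b y
    into C, which forces b = 0, and then a x into A.\<close>
  have "j \<gamma> \<in> D" using ab(3) xy(3) W(4) convex_subgroups_D(4,6)[OF assms(4)] by metis
  then have "j \<gamma> \<in> C" using assms(9) ab(2) by (auto simp: contraction_def)
  moreover have "imul b y = j \<gamma> + - imul a x" using ab(3) by (simp add: algebra_simps)
  ultimately have "imul b y \<in> C"
    using W(3) convex_subgroups_D(4,5,6)[OF assms(3)] by metis
  then have b: "b = 0" using convex_subgroups_imul_D[OF assms(3)] xy(4) W(2) by blast
  then have "j \<gamma> \<in> B" using ab(3) convex_subgroups_D(6)[OF assms(2) xy(1), of a] by simp
  then have "imul a x \<in> A" using b assms(8) ab(2,3) by (auto simp: contraction_def)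
  then show False using convex_subgroups_imul_D[OF assms(1)] xy(2) W(1) ab(1) b by blast
qed

text \<open>Once the upper member B of the given pair is dropped, contraction is a bijection onto
  the convex subgroups of V.\<close>

lemma has_rank_jump:
  assumes "has_rank V n"
    and A: "A \<in> convex_subgroups W" and B: "B \<in> convex_subgroups W"
    and "A \<subset> B" and AB: "contraction A = contraction B"
  shows "has_rank W (n + 1)"
proof -
  let ?S = "convex_subgroups W - {B}"
  have no_sub: False
    if C: "C \<in> ?S" and D: "D \<in> ?S" and "C \<subset> D" and CD: "contraction C = contraction D" for C D
  proof -
    have CD': "C \<in> convex_subgroups W" "D \<in> convex_subgroups W" "C \<noteq> B" "D \<noteq> B"
      using C D by auto
    \<comment> \<open>A second pair can lie neither above B nor below A, so the two intervals
      overlap; monotonicity of contraction then yields three nested subgroups with one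
      contraction.\<close>
    have "\<not> B \<subseteq> C" using no_two_jumps[OF A B CD'(1,2) assms(4) _ \<open>C \<subset> D\<close> AB CD] by blast
    then have CB: "C \<subset> B" using convex_subgroups_chain[OF CD'(1) B] by blast
    have "\<not> D \<subseteq> A" using no_two_jumps[OF CD'(1,2) A B \<open>C \<subset> D\<close> _ assms(4) CD AB] by blast
    then have AD: "A \<subset> D" using convex_subgroups_chain[OF CD'(2) A] by blast
    consider "D \<subset> B" | "B \<subset> D" using convex_subgroups_chain[OF CD'(2) B] CD'(4) by blast
    then show False
    proof cases
      case 1
      then have "contraction A = contraction D" "contraction D = contraction B"
        using AB contraction_mono[of A D] contraction_mono[of D B] AD by blast+
      then show False using no_two_jumps[OF A CD'(2) CD'(2) B AD subset_refl 1] by blast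
    next
      case 2
      then have "contraction C = contraction B" "contraction B = contraction D"
        using CD contraction_mono[of C B] contraction_mono[of B D] CB by blast+
      then show False using no_two_jumps[OF CD'(1) B B CD'(2) CB subset_refl 2] by blast
    qed
  qed
  have inj: "inj_on contraction ?S"
  proof (rule inj_onI, rule ccontr)
    fix C D assume *: "C \<in> ?S" "D \<in> ?S" "contraction C = contraction D" "C \<noteq> D"
    then have "C \<subset> D \<or> D \<subset> C" using convex_subgroups_chain[of C W D] by blast
    then show False using no_sub[of C D] no_sub[of D C] * by auto
  qed
  have "contraction ` ?S = convex_subgroups V"
  proof
    show "contraction ` ?S \<subseteq> convex_subgroups V" using contraction_convex_subgroup by blast
    show "convex_subgroups V \<subseteq> contraction ` ?S"
    proof
      fix D assume D: "D \<in> convex_subgroups V"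
      define C where "C = convex_hull_in W (j ` D)"
      have "C \<in> convex_subgroups W"
        unfolding C_def using convex_subgroups_D(1,2)[OF D]
        by (intro convex_hull_in_convex_subgroup W image_add_subgroup)
      moreover have "contraction C = D" using contraction_hull[OF D] by (simp add: C_def)
      \<comment> \<open>If the hull happens to be the dropped subgroup B, then A is a preimage
        instead.\<close>
      ultimately show "D \<in> contraction ` ?S" using A AB assms(4) by (cases "C = B") blast+
    qed
  qed
  then have "bij_betw contraction ?S (convex_subgroups V)" using inj by (simp add: bij_betw_def)
  then have "finite ?S \<longleftrightarrow> finite (convex_subgroups V)" "card ?S = card (convex_subgroups V)"
    using bij_betw_finite bij_betw_same_card by blast+
  moreover have "convex_subgroups W = insert B ?S" using B by blast
  ultimately show ?thesis
    using assms(1) unfolding has_rank_iff[OF V] has_rank_iff[OF W]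
    by (metis Diff_iff Suc_eq_plus1 card_insert_disjoint finite_insert insertI1)
qed

end

section \<open>Finite values of a valuation\<close>

text \<open>The value 0 at \<open>Pinf\<close> is a default; the arithmetic laws below are therefore
  stated for nonzero arguments.\<close>

definition fval :: "('k::field \<Rightarrow> 'g::linordered_ab_group_add extended) \<Rightarrow> 'k \<Rightarrow> 'g" where
  "fval v x = (case v x of Fin \<gamma> \<Rightarrow> \<gamma> | _ \<Rightarrow> 0)"

locale krull_val =
  fixes v :: "'k::field \<Rightarrow> 'g::linordered_ab_group_add extended"
  assumes krull: "krull_valuation v"
begin

lemma v_eq_Pinf_iff: "v x = Pinf \<longleftrightarrow> x = 0"
  and v_not_Minf: "v x \<noteq> Minf"
  and v_mult: "v (x * y) = v x + v y"
  and v_add_ge: "min (v x) (v y) \<le> v (x + y)"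
  using krull by (auto simp: krull_valuation_def)

lemma v_0 [simp]: "v 0 = Pinf"
  by (simp add: v_eq_Pinf_iff)

lemma v_eq_Fin: "x \<noteq> 0 \<Longrightarrow> v x = Fin (fval v x)"
  using v_eq_Pinf_iff[of x] v_not_Minf[of x] by (cases "v x") (auto simp: fval_def)

lemma v_eq_Fin_iff: "v x = Fin \<gamma> \<longleftrightarrow> x \<noteq> 0 \<and> fval v x = \<gamma>"
  using v_eq_Fin[of x] by (cases "x = 0") auto

lemma v_neq_0_of_less: "v x < c \<Longrightarrow> x \<noteq> 0"
  by auto

lemma fval_mult: "x \<noteq> 0 \<Longrightarrow> y \<noteq> 0 \<Longrightarrow> fval v (x * y) = fval v x + fval v y"
  using v_mult[of x y] by (simp add: v_eq_Fin)

lemma fval_1 [simp]: "fval v 1 = 0"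
  using fval_mult[of 1 1] by simp

text \<open>The square of -1 has value 0, and an ordered group is torsion free.\<close>

lemma fval_m1 [simp]: "fval v (- 1) = 0"
proof -
  have "imul 2 (fval v (- 1)) = 0"
    using fval_mult[of "-1" "-1"] imul_add_left[of 1 1 "fval v (- 1)"] by simp
  then show ?thesis by (simp add: imul_eq_0_iff)
qed

lemma v_uminus [simp]: "v (- x) = v x"
proof (cases "x = 0")
  case False
  then show ?thesis using v_mult[of "- 1" x] by (simp add: v_eq_Fin)
qed simp

lemma v_minus_commute: "v (x - y) = v (y - x)"
  using v_uminus[of "x - y"] by simp

lemma fval_inverse: "x \<noteq> 0 \<Longrightarrow> fval v (inverse x) = - fval v x"
  using fval_mult[of x "inverse x"] by (simp add: eq_neg_iff_add_eq_0 add.commute)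

lemma fval_divide: "x \<noteq> 0 \<Longrightarrow> y \<noteq> 0 \<Longrightarrow> fval v (x / y) = fval v x - fval v y"
  using fval_mult[of x "inverse y"] by (simp add: fval_inverse divide_inverse)

lemma fval_power: "x \<noteq> 0 \<Longrightarrow> fval v (x ^ n) = imul (int n) (fval v x)"
proof (induction n)
  case (Suc n)
  then show ?case using imul_Suc[of n "fval v x"] by (simp add: fval_mult add.commute)
qed simp

lemma value_group_iff: "\<gamma> \<in> value_group v \<longleftrightarrow> (\<exists>x. x \<noteq> 0 \<and> fval v x = \<gamma>)"
  by (simp add: value_group_def v_eq_Fin_iff)

lemma fval_in: "x \<noteq> 0 \<Longrightarrow> fval v x \<in> value_group v"
  using value_group_iff by blast

lemma add_subgroup_value_group: "add_subgroup (value_group v)"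
proof -
  have "a + b \<in> value_group v" if ab: "a \<in> value_group v" "b \<in> value_group v" for a b
  proof -
    obtain x y where "x \<noteq> 0" "fval v x = a" "y \<noteq> 0" "fval v y = b"
      using ab unfolding value_group_iff by blast
    then show ?thesis using fval_in[of "x * y"] fval_mult[of x y] by simp
  qed
  moreover have "- a \<in> value_group v" if a: "a \<in> value_group v" for a
  proof -
    obtain x where "x \<noteq> 0" "fval v x = a" using a unfolding value_group_iff by blast
    then show ?thesis using fval_in[of "inverse x"] fval_inverse[of x] by simp
  qed
  ultimately show ?thesis using fval_in[of 1] by (auto simp: add_subgroup_def)
qed

lemma v_add_less:
  assumes "v x < v y"
  shows "v (x + y) = v x"
proof (rule antisym)
  show "v x \<le> v (x + y)" using v_add_ge[of x y] assms by simp
  show "v (x + y) \<le> v x"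
  proof (rule ccontr)
    assume "\<not> ?thesis"
    then have "v x < min (v (x + y)) (v (- y))" using assms by simp
    also have "\<dots> \<le> v (x + y + - y)" by (rule v_add_ge)
    finally show False by simp
  qed
qed

lemma v_sum_greater:
  assumes "finite A" "\<And>x. x \<in> A \<Longrightarrow> c < v (f x)" "c < Pinf"
  shows "c < v (sum f A)"
  using assms
proof (induction A rule: finite_induct)
  case (insert a A)
  then have "c < min (v (f a)) (v (sum f A))" by simp
  also have "\<dots> \<le> v (f a + sum f A)" by (rule v_add_ge)
  finally show ?case using insert by simp
qed simp

text \<open>In a vanishing sum the least value occurs twice, since a single term of least value
  would determine the value of the sum. The index in the hypotheses only guarantees a nonzero term
  and is unrelated to the one obtained.\<close>

lemma sum_eq_0_equal_values:
  assumes "finite A" "sum f A = 0" "i \<in> A" "f i \<noteq> 0"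
  obtains i j where "i \<in> A" "j \<in> A" "i \<noteq> j" "f i \<noteq> 0" "f j \<noteq> 0" "fval v (f i) = fval v (f j)"
proof -
  define B where "B = {i\<in>A. f i \<noteq> 0}"
  have "finite B" using assms(1) by (simp add: B_def)
  moreover have "i \<in> B" using assms(3,4) by (simp add: B_def)
  ultimately have B: "finite B" "B \<noteq> {}" by blast+
  have "sum f B = sum f A" by (intro sum.mono_neutral_left assms(1)) (auto simp: B_def)
  then have sumB: "sum f B = 0" using assms(2) by (rule trans)
  define m where "m = arg_min_on (\<lambda>k. fval v (f k)) B"
  have m: "m \<in> B" "\<And>k. k \<in> B \<Longrightarrow> fval v (f m) \<le> fval v (f k)"
    unfolding m_def by (rule arg_min_if_finite(1)[OF B], rule arg_min_least[OF B])
  have "\<exists>j\<in>B. j \<noteq> m \<and> fval v (f j) = fval v (f m)"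
  proof (rule ccontr)
    assume neg: "\<not> ?thesis"
    have "v (f m) < v (sum f (B - {m}))"
    proof (rule v_sum_greater)
      show "v (f m) < v (f k)" if "k \<in> B - {m}" for k
        using that m neg by (auto simp: B_def v_eq_Fin less_le)
    qed (use B m in \<open>auto simp: B_def v_eq_Fin\<close>)
    then have "v (f m + sum f (B - {m})) = v (f m)" by (rule v_add_less)
    moreover have "f m + sum f (B - {m}) = 0" using sumB m(1) B(1) by (simp add: sum.remove)
    ultimately show False using m(1) by (simp add: B_def v_eq_Fin)
  qed
  then show ?thesis using that m(1) unfolding B_def by (metis (mono_tags, lifting) mem_Collect_eq)
qed

end

section \<open>The extension to the algebraic closure\<close>

locale closure_val = K: krull_val v + L: krull_val vbar
  for v :: "'a::field \<Rightarrow> 'g::linordered_ab_group_add extended"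
    and vbar :: "'a alg_closure \<Rightarrow> 'g extended" +
  assumes ext: "\<And>x. vbar (to_ac x) = v x"
begin

lemma fval_ext: "fval vbar (to_ac x) = fval v x"
  by (simp add: fval_def ext)

lemma value_group_subset: "value_group v \<subseteq> value_group vbar"
  unfolding value_group_def ext[symmetric] by blast

text \<open>Two terms of equal value in an algebraic equation for a, of degrees i < j, exhibit (j -
  i) \<open>\<gamma>\<close> as the value of a quotient of coefficients.\<close>

lemma value_group_torsion:
  assumes "\<gamma> \<in> value_group vbar"
  shows "\<exists>n>0. imul n \<gamma> \<in> value_group v"
proof -
  obtain a where a: "a \<noteq> 0" "fval vbar a = \<gamma>" using assms L.value_group_iff by blast
  obtain p :: "'a poly" where p: "p \<noteq> 0" "poly (map_poly to_ac p) a = 0"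
    using alg_closure_algebraic by blast
  define f where "f i = to_ac (coeff p i) * a ^ i" for i
  have "degree (map_poly to_ac p) = degree p" by (rule degree_map_poly) auto
  then have sum: "sum f {..degree p} = 0"
    using p(2) by (simp add: poly_altdef f_def coeff_map_poly)
  have "f (degree p) \<noteq> 0" using p(1) a(1) by (simp add: f_def)
  then obtain i j where ij: "i \<noteq> j" "f i \<noteq> 0" "f j \<noteq> 0" "fval vbar (f i) = fval vbar (f j)"
    using L.sum_eq_0_equal_values[OF _ sum, of "degree p"] by (metis atMost_iff finite_atMost le_refl)
  have *: "\<exists>n>0. imul n \<gamma> \<in> value_group v"
    if "i < j" "f i \<noteq> 0" "f j \<noteq> 0" "fval vbar (f i) = fval vbar (f j)" for i j
  proof -
    have c: "coeff p i \<noteq> 0" "coeff p j \<noteq> 0" using that by (auto simp: f_def)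
    then have "fval v (coeff p i) + imul (int i) \<gamma> = fval v (coeff p j) + imul (int j) \<gamma>"
      using that(4) a by (simp add: f_def L.fval_mult L.fval_power fval_ext)
    then have "imul (int j - int i) \<gamma> = fval v (coeff p i) - fval v (coeff p j)"
      by (simp add: imul.scale_left_diff_distrib algebra_simps)
    also have "\<dots> = fval v (coeff p i / coeff p j)" using c by (simp add: K.fval_divide)
    also have "\<dots> \<in> value_group v" using c by (intro K.fval_in) simp
    finally show ?thesis using that(1) by (intro exI[of _ "int j - int i"]) simp
  qed
  show ?thesis using *[of i j] *[of j i] ij by (cases i j rule: linorder_cases) auto
qed

text \<open>The n-th part of the value of a is the value of an n-th root of a in the algebraic
  closure.\<close>

lemma value_group_divisible:
  assumes "\<gamma> \<in> value_group vbar" "0 < n"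
  shows "\<exists>\<eta>\<in>value_group vbar. imul n \<eta> = \<gamma>"
proof -
  obtain a where a: "a \<noteq> 0" "fval vbar a = \<gamma>" using assms L.value_group_iff by blast
  obtain b where b: "b ^ nat n = a" using nth_root_exists[of "nat n" a] assms(2) by auto
  then have "b \<noteq> 0" using a(1) assms(2) by (auto simp: zero_power)
  then show ?thesis
    using L.fval_power[of b "nat n"] L.fval_in[of b] a(2) b assms(2) by auto
qed

lemma poly_map_to_ac: "poly (map_poly to_ac p) (to_ac x) = to_ac (poly p x)"
  by (induction p) (simp_all add: map_poly_pCons)

lemma map_poly_to_ac_eq_0_iff: "map_poly to_ac p = 0 \<longleftrightarrow> p = 0"
  by (simp add: poly_eq_iff coeff_map_poly)

end

section \<open>Pseudo convergent and pseudo divergent sequences\<close>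

lemma less_succ_idx: "\<nu> < succ_idx \<nu>"
  unfolding succ_idx_def using gt_ex[of \<nu>] by (rule LeastI_ex)

lemma succ_idx_le: "\<nu> < \<mu> \<Longrightarrow> succ_idx \<nu> \<le> \<mu>"
  unfolding succ_idx_def by (rule Least_le)

definition pcs_delta ::
  "('k::field \<Rightarrow> 'g::linordered_ab_group_add extended) \<Rightarrow> ('i::{wellorder,no_top} \<Rightarrow> 'k) \<Rightarrow> 'i \<Rightarrow> 'g" where
  "pcs_delta v z \<nu> = fval v (z \<nu> - z (succ_idx \<nu>))"

definition first_idx :: "'i::wellorder" where
  "first_idx = (LEAST \<nu>. True)"

lemma first_idx_le: "first_idx \<le> \<nu>"
  unfolding first_idx_def by (rule Least_le) simp

text \<open>The first term serves as common comparison term. At the first index, and possibly at the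
  second, the result is only the default of \<open>fval\<close>.\<close>

definition pds_delta ::
  "('k::field \<Rightarrow> 'g::linordered_ab_group_add extended) \<Rightarrow> ('i::{wellorder,no_top} \<Rightarrow> 'k) \<Rightarrow> 'i \<Rightarrow> 'g" where
  "pds_delta v z \<nu> = fval v (z \<nu> - z first_idx)"

context krull_val
begin

text \<open>Split at the successor of \<open>\<nu>\<close>: the part from the successor to
  \<open>\<mu>\<close> has larger value and does not matter.\<close>

lemma pcs_v_diff:
  assumes "pseudo_convergent v z" "\<nu> < \<mu>"
  shows "v (z \<nu> - z \<mu>) = Fin (pcs_delta v z \<nu>)"
proof -
  let ?s = "succ_idx \<nu>"
  have less: "v (z \<nu> - z ?s) < v (z ?s - z \<rho>)" if "?s < \<rho>" for \<rho>
    using assms(1) less_succ_idx[of \<nu>] that by (auto simp: pseudo_convergent_def)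
  have s: "v (z \<nu> - z ?s) = Fin (pcs_delta v z \<nu>)"
    unfolding pcs_delta_def by (rule v_eq_Fin, rule v_neq_0_of_less, rule less, rule less_succ_idx)
  show ?thesis
  proof (cases "\<mu> = ?s")
    case False
    then have "v (z \<nu> - z ?s) < v (z ?s - z \<mu>)"
      using less succ_idx_le[OF assms(2)] by auto
    from v_add_less[OF this] show ?thesis using s by simp
  qed (use s in simp)
qed

lemma pcs_delta_less:
  assumes "pseudo_convergent v z" "\<nu> < \<mu>"
  shows "pcs_delta v z \<nu> < pcs_delta v z \<mu>"
proof -
  have "v (z \<nu> - z \<mu>) < v (z \<mu> - z (succ_idx \<mu>))"
    using assms less_succ_idx[of \<mu>] by (auto simp: pseudo_convergent_def)
  then show ?thesis
    by (simp add: pcs_v_diff[OF assms] pcs_v_diff[OF assms(1) less_succ_idx])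
qed

lemma pcs_gauge_eq:
  assumes "pseudo_convergent v z"
  shows "pcs_gauge v z = range (pcs_delta v z)"
  by (auto simp: pcs_gauge_def pcs_v_diff[OF assms less_succ_idx])

lemma pcs_delta_in:
  assumes "pseudo_convergent v z"
  shows "pcs_delta v z \<nu> \<in> value_group v"
  using pcs_v_diff[OF assms less_succ_idx, of \<nu>] by (auto simp: value_group_def)

text \<open>Either some term is farther from a than from its successors, and then all later terms
  keep that distance to a; or a is a pseudo limit. It is used over the algebraic closure, with a an
  arbitrary root.\<close>

lemma pcs_v_minus:
  assumes "pseudo_convergent v z"
  shows "(\<exists>c\<in>value_group v. \<forall>\<^sub>F \<nu> in at_top. v (z \<nu> - a) = Fin c) \<or>
    (\<forall>\<nu>. v (z \<nu> - a) = Fin (pcs_delta v z \<nu>))"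
proof (cases "\<exists>\<nu>. v (z \<nu> - a) < Fin (pcs_delta v z \<nu>)")
  case True
  then obtain \<nu> where \<nu>: "v (z \<nu> - a) < Fin (pcs_delta v z \<nu>)" by blast
  have c: "v (z \<nu> - a) = Fin (fval v (z \<nu> - a))"
    by (rule v_eq_Fin, rule v_neq_0_of_less, rule \<nu>)
  have "v (z \<mu> - a) = Fin (fval v (z \<nu> - a))" if "\<nu> < \<mu>" for \<mu>
  proof -
    have "v (z \<nu> - a) < v (z \<mu> - z \<nu>)"
      using \<nu> pcs_v_diff[OF assms that] by (simp add: v_minus_commute)
    from v_add_less[OF this] show ?thesis using c by simp
  qed
  then have "\<forall>\<^sub>F \<mu> in at_top. v (z \<mu> - a) = Fin (fval v (z \<nu> - a))"
    by (rule eventually_mono[OF eventually_gt_at_top])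
  moreover have "fval v (z \<nu> - a) \<in> value_group v" using c by (auto simp: value_group_def)
  ultimately show ?thesis by blast
next
  case False
  \<comment> \<open>Only \<ge> is known so far. At the successor it gives a value strictly above
    that of z \<open>\<nu>\<close> - z ?s, so the latter decides.\<close>
  have "v (z \<nu> - a) = Fin (pcs_delta v z \<nu>)" for \<nu>
  proof -
    let ?s = "succ_idx \<nu>"
    have "v (z \<nu> - z ?s) < Fin (pcs_delta v z ?s)"
      using pcs_delta_less[OF assms less_succ_idx, of \<nu>]
      by (simp add: pcs_v_diff[OF assms less_succ_idx])
    also have "\<dots> \<le> v (z ?s - a)" using False by (simp add: not_less)
    finally have "v (z \<nu> - z ?s + (z ?s - a)) = v (z \<nu> - z ?s)" by (rule v_add_less)
    then show ?thesis by (simp add: pcs_v_diff[OF assms less_succ_idx])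
  qed
  then show ?thesis by blast
qed

text \<open>The first two terms of a pseudo divergent sequence may coincide, hence the bound on \<open>\<nu>\<close>.\<close>

lemma pds_v_diff:
  fixes z :: "'i::{wellorder,no_top} \<Rightarrow> 'k"
  assumes "pseudo_divergent v z" "succ_idx first_idx < \<nu>" "\<mu> < \<nu>"
  shows "v (z \<nu> - z \<mu>) = Fin (pds_delta v z \<nu>)"
proof -
  let ?s = "succ_idx (first_idx :: 'i)"
  have less: "v (z \<nu>2 - z \<nu>3) < v (z \<nu>1 - z \<nu>2)" if "\<nu>1 < \<nu>2" "\<nu>2 < \<nu>3" for \<nu>1 \<nu>2 \<nu>3
    using assms(1) that by (auto simp: pseudo_divergent_def)
  \<comment> \<open>Changing the comparison term from \<open>\<rho>\<close> to
    \<open>first_idx\<close> adds the difference of these two terms, whose value is larger by pseudo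
    divergence.\<close>
  have eq: "v (z \<nu> - z \<rho>) = v (z \<nu> - z first_idx)" if "\<rho> < \<nu>" for \<rho>
  proof (cases "\<rho> = first_idx")
    case False
    then have "first_idx < \<rho>" using first_idx_le[of \<rho>] by (simp add: less_le)
    then have "v (z \<nu> - z \<rho>) < v (z \<rho> - z first_idx)"
      using less[of first_idx \<rho> \<nu>] that by (simp add: v_minus_commute)
    from v_add_less[OF this] show ?thesis by simp
  qed simp
  \<comment> \<open>Finiteness of the value: being strictly below another value, it is not
    \<open>Pinf\<close>. This needs two indices before \<open>\<nu>\<close>.\<close>
  have "v (z ?s - z \<nu>) < v (z first_idx - z ?s)"
    using less[OF less_succ_idx assms(2)] .
  then have "z \<nu> - z ?s \<noteq> 0" using v_neq_0_of_less by fastforce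
  then have "v (z \<nu> - z ?s) \<noteq> Pinf" using v_eq_Pinf_iff by blast
  then have "z \<nu> - z first_idx \<noteq> 0" using eq[OF assms(2)] v_eq_Pinf_iff by metis
  then show ?thesis using eq[OF assms(3)] v_eq_Fin unfolding pds_delta_def by simp
qed

lemma pds_delta_less:
  assumes "pseudo_divergent v z" "succ_idx first_idx < \<nu>" "\<nu> < \<mu>"
  shows "pds_delta v z \<mu> < pds_delta v z \<nu>"
proof -
  have i: "first_idx < \<nu>" using less_succ_idx assms(2) by (rule less_trans)
  have "v (z \<nu> - z \<mu>) < v (z first_idx - z \<nu>)"
    using assms i by (auto simp: pseudo_divergent_def)
  then have "v (z \<mu> - z \<nu>) < v (z \<nu> - z first_idx)" by (simp add: v_minus_commute)
  then show ?thesis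
    using pds_v_diff[OF assms(1) less_trans[OF assms(2,3)] assms(3)] pds_v_diff[OF assms(1,2) i] by simp
qed

lemma pds_delta_in_gauge:
  assumes "pseudo_divergent v z" "succ_idx first_idx < \<nu>"
  shows "pds_delta v z \<nu> \<in> pds_gauge v z" "pds_delta v z \<nu> \<in> value_group v"
proof -
  have *: "v (z \<nu> - z (succ_idx first_idx)) = Fin (pds_delta v z \<nu>)"
    by (rule pds_v_diff[OF assms assms(2)])
  then show "pds_delta v z \<nu> \<in> value_group v" unfolding value_group_def by blast
  show "pds_delta v z \<nu> \<in> pds_gauge v z"
    unfolding pds_gauge_def using assms(2) *[symmetric] by blast
qed

lemma pds_gauge_greater:
  assumes "pseudo_divergent v z" "\<delta> \<in> pds_gauge v z"
  obtains \<nu> where "succ_idx first_idx < \<nu>" "pds_delta v z \<nu> < \<delta>"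
proof -
  obtain \<nu> \<mu> where \<nu>: "\<mu> < \<nu>" "Fin \<delta> = v (z \<nu> - z \<mu>)" using assms(2) by (auto simp: pds_gauge_def)
  obtain \<rho> where \<rho>: "max \<nu> (succ_idx first_idx) < \<rho>" using gt_ex by blast
  then have "v (z \<nu> - z \<rho>) < v (z \<mu> - z \<nu>)"
    using assms(1) \<nu>(1) by (auto simp: pseudo_divergent_def)
  then have "v (z \<rho> - z \<nu>) < v (z \<nu> - z \<mu>)" by (simp add: v_minus_commute)
  then have "pds_delta v z \<rho> < \<delta>"
    using pds_v_diff[OF assms(1), of \<rho> \<nu>] \<rho> \<nu>(2)[symmetric] by simp
  then show ?thesis using that[of \<rho>] \<rho> by simp
qed

text \<open>If a is closer to some term than a later gauge value indicates, the sequence moves away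
  from a exactly as it moves away from that term. Otherwise a is so far out that the differences of
  terms do not change the distance to it.\<close>

lemma pds_v_minus:
  fixes z :: "'i::{wellorder,no_top} \<Rightarrow> 'k"
  assumes "pseudo_divergent v z"
  shows "(\<exists>c\<in>value_group v. \<forall>\<^sub>F \<nu> in at_top. v (z \<nu> - a) = Fin c) \<or>
    (\<forall>\<^sub>F \<nu> in at_top. v (z \<nu> - a) = Fin (pds_delta v z \<nu>))"
proof (cases "\<exists>\<nu> \<mu>. succ_idx first_idx < \<nu> \<and> \<mu> < \<nu> \<and> Fin (pds_delta v z \<nu>) < v (z \<mu> - a)")
  case True
  then obtain \<nu> \<mu> where \<nu>: "succ_idx first_idx < \<nu>" "\<mu> < \<nu>" "Fin (pds_delta v z \<nu>) < v (z \<mu> - a)"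
    by blast
  have "v (z \<rho> - a) = Fin (pds_delta v z \<rho>)" if "\<nu> < \<rho>" for \<rho>
  proof -
    have \<rho>: "succ_idx first_idx < \<rho>" "\<mu> < \<rho>" using \<nu> that by auto
    have "v (z \<rho> - z \<mu>) < Fin (pds_delta v z \<nu>)"
      using pds_v_diff[OF assms \<rho>] pds_delta_less[OF assms \<nu>(1) that] by simp
    also note \<nu>(3)
    finally have "v (z \<rho> - z \<mu> + (z \<mu> - a)) = v (z \<rho> - z \<mu>)" by (rule v_add_less)
    then show ?thesis using pds_v_diff[OF assms \<rho>] by simp
  qed
  then have "\<forall>\<^sub>F \<nu> in at_top. v (z \<nu> - a) = Fin (pds_delta v z \<nu>)"
    by (rule eventually_mono[OF eventually_gt_at_top])
  then show ?thesis by blast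
next
  case False
  then have le: "v (z \<mu> - a) \<le> Fin (pds_delta v z \<nu>)" if "succ_idx first_idx < \<nu>" "\<mu> < \<nu>" for \<mu> \<nu>
    using that by (meson not_less)
  obtain \<mu> where \<mu>: "succ_idx first_idx < (\<mu> :: 'i)" using gt_ex by blast
  have const: "v (z \<nu> - a) = v (z \<mu> - a)" if "\<mu> < \<nu>" for \<nu>
  proof -
    have \<nu>: "succ_idx first_idx < \<nu>" using \<mu> that by simp
    \<comment> \<open>Going to the successor of \<open>\<nu>\<close> and back gains the strict
      inequality that \<open>v_add_less\<close> requires.\<close>
    have "v (z \<mu> - a) \<le> Fin (pds_delta v z (succ_idx \<nu>))"
      using less_succ_idx[of \<nu>] \<nu> that by (intro le) auto
    also have "\<dots> < v (z \<nu> - z \<mu>)"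
      using pds_v_diff[OF assms \<nu> that] pds_delta_less[OF assms \<nu> less_succ_idx] by simp
    finally have "v (z \<mu> - a + (z \<nu> - z \<mu>)) = v (z \<mu> - a)" by (rule v_add_less)
    then show ?thesis by simp
  qed
  have "v (z \<mu> - a) < Pinf"
    using le[of "succ_idx \<mu>" \<mu>] \<mu> less_succ_idx[of \<mu>] by (metis le_less_trans less_extended_simps(2) less_trans)
  then have c: "v (z \<mu> - a) = Fin (fval v (z \<mu> - a))" by (intro v_eq_Fin v_neq_0_of_less)
  have "\<forall>\<^sub>F \<nu> in at_top. v (z \<nu> - a) = v (z \<mu> - a)"
    by (rule eventually_mono[OF eventually_gt_at_top const])
  then have "\<forall>\<^sub>F \<nu> in at_top. v (z \<nu> - a) = Fin (fval v (z \<mu> - a))" unfolding c .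
  moreover have "fval v (z \<mu> - a) \<in> value_group v" using c by (auto simp: value_group_def)
  ultimately show ?thesis by blast
qed

end

section \<open>Value groups described by germs\<close>

text \<open>
  \<open>R x g\<close> says that \<open>x\<close> is the value of a rational function \<open>\<phi>\<close> with \<open>v (\<phi> (z \<nu>)) = g \<nu>\<close> for all large
  \<open>\<nu>\<close>; \<open>\<epsilon> \<nu>\<close> stands for \<open>\<delta>\<^sub>\<nu>\<close> if the sequence is pseudo convergent and for \<open>- \<delta>\<^sub>\<nu>\<close> if it is pseudo
  divergent.
\<close>

locale germ_values =
  fixes V G :: "'g::linordered_ab_group_add set"
    and W :: "'h::linordered_ab_group_add set"
    and R :: "'h \<Rightarrow> ('i::{wellorder,no_top} \<Rightarrow> 'g) \<Rightarrow> bool"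
    and \<epsilon> :: "'i \<Rightarrow> 'g"
  assumes V: "add_subgroup V" and G: "add_subgroup G" and VG: "V \<subseteq> G"
    and torsion: "\<And>g. g \<in> G \<Longrightarrow> \<exists>n>0. imul n g \<in> V"
    and divisible: "\<And>g n. g \<in> G \<Longrightarrow> 0 < n \<Longrightarrow> \<exists>h\<in>G. imul n h = g"
    and W_iff: "\<And>x. x \<in> W \<longleftrightarrow> (\<exists>g. R x g)"
    and R_add: "\<And>x y g h. R x g \<Longrightarrow> R y h \<Longrightarrow> R (x + y) (\<lambda>\<nu>. g \<nu> + h \<nu>)"
    and R_uminus: "\<And>x g. R x g \<Longrightarrow> R (- x) (\<lambda>\<nu>. - g \<nu>)"
    and R_nonneg: "\<And>x g. R x g \<Longrightarrow> 0 \<le> x \<longleftrightarrow> (\<forall>\<^sub>F \<nu> in at_top. 0 \<le> g \<nu>)"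
    and R_const: "\<And>\<gamma>. \<gamma> \<in> V \<Longrightarrow> \<exists>x. R x (\<lambda>_. \<gamma>)"
    and R_germ: "\<And>x g. R x g \<Longrightarrow> \<exists>m. \<exists>\<gamma>\<in>G. \<forall>\<^sub>F \<nu> in at_top. g \<nu> = imul m (\<epsilon> \<nu>) + \<gamma>"
    and R_nonconst: "\<exists>x g m. m \<noteq> 0 \<and> R x g \<and> (\<exists>\<gamma>\<in>G. \<forall>\<^sub>F \<nu> in at_top. g \<nu> = imul m (\<epsilon> \<nu>) + \<gamma>)"
begin

lemma at_top_neq_bot: "(at_top :: 'i filter) \<noteq> bot"
  by (rule trivial_limit_at_top_linorder)

lemma R_le:
  assumes "R x g" "R y h"
  shows "x \<le> y \<longleftrightarrow> (\<forall>\<^sub>F \<nu> in at_top. g \<nu> \<le> h \<nu>)"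
  using R_nonneg[OF R_add[OF assms(2) R_uminus[OF assms(1)]]] by simp

lemma R_less:
  assumes "R x g" "R y h" and ev: "\<forall>\<^sub>F \<nu> in at_top. g \<nu> < h \<nu>"
  shows "x < y"
proof (rule ccontr)
  assume "\<not> x < y"
  then have "y \<le> x" by simp
  then have "\<forall>\<^sub>F \<nu> in at_top. h \<nu> \<le> g \<nu>" using R_le[OF assms(2,1)] by blast
  with ev have "\<forall>\<^sub>F \<nu> in (at_top :: 'i filter). False" by eventually_elim simp
  then show False using at_top_neq_bot by simp
qed

lemma R_eq:
  assumes "R x g" "R y h" "\<forall>\<^sub>F \<nu> in at_top. g \<nu> = h \<nu>"
  shows "x = y"
proof (rule antisym)
  show "x \<le> y" using R_le[OF assms(1,2)] assms(3) by (auto elim: eventually_mono)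
  show "y \<le> x" using R_le[OF assms(2,1)] assms(3) by (auto elim: eventually_mono)
qed

text \<open>The embedding of V into W. By \<open>R_eq\<close> the choice is immaterial.\<close>

definition const_value :: "'g \<Rightarrow> 'h" where
  "const_value \<gamma> = (SOME x. R x (\<lambda>_. \<gamma>))"

lemma R_const_value: "\<gamma> \<in> V \<Longrightarrow> R (const_value \<gamma>) (\<lambda>_. \<gamma>)"
  unfolding const_value_def by (rule someI_ex[OF R_const])

lemma R_0: "R 0 (\<lambda>_. 0)"
proof -
  have "R (const_value 0) (\<lambda>_. 0)" using R_const_value V by (simp add: add_subgroup_def)
  from R_add[OF this R_uminus[OF this]] show ?thesis by simp
qed

lemma R_imul:
  assumes "R x g"
  shows "R (imul k x) (\<lambda>\<nu>. imul k (g \<nu>))"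
proof (induction k rule: int_induct[where k = 0])
  case base
  then show ?case using R_0 by simp
next
  case (step1 i)
  then show ?case using R_add[OF step1(2) assms] by (simp add: imul_add_left)
next
  case (step2 i)
  then show ?case
    using R_add[OF step2(2) R_uminus[OF assms]] by (simp add: imul.scale_left_diff_distrib)
qed

lemma W: "add_subgroup W"
  unfolding add_subgroup_def Ball_def W_iff
proof (intro conjI allI impI)
  show "\<exists>g. R 0 g" by (rule exI, rule R_0)
  show "\<exists>g. R (x + y) g" if "\<exists>g. R x g" and "\<exists>g. R y g" for x y
    using that by (elim exE) (rule exI, erule (1) R_add)
  show "\<exists>g. R (- x) g" if "\<exists>g. R x g" for x
    using that by (elim exE) (rule exI, erule R_uminus)
qed

lemma const_value_le:
  assumes "\<alpha> \<in> V" "\<beta> \<in> V"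
  shows "const_value \<alpha> \<le> const_value \<beta> \<longleftrightarrow> \<alpha> \<le> \<beta>"
  using R_le[OF R_const_value[OF assms(1)] R_const_value[OF assms(2)]] at_top_neq_bot
  by (simp add: eventually_const)

text \<open>Crosswise multiplication with the coefficients n and -m cancels
  \<open>\<epsilon>\<close>; what remains is a constant in G, and a further factor N moves it into
  V.\<close>

lemma germ_rel_rank:
  assumes "x \<in> W" "y \<in> W"
  shows "\<exists>a b \<gamma>. (a \<noteq> 0 \<or> b \<noteq> 0) \<and> \<gamma> \<in> V \<and> imul a x + imul b y = const_value \<gamma>"
proof -
  obtain g h where R: "R x g" "R y h" using assms W_iff by blast
  obtain m \<alpha> where x: "\<alpha> \<in> G" "\<forall>\<^sub>F \<nu> in at_top. g \<nu> = imul m (\<epsilon> \<nu>) + \<alpha>"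
    using R_germ[OF R(1)] by blast
  obtain n \<beta> where y: "\<beta> \<in> G" "\<forall>\<^sub>F \<nu> in at_top. h \<nu> = imul n (\<epsilon> \<nu>) + \<beta>"
    using R_germ[OF R(2)] by blast
  obtain a b where ab: "a \<noteq> 0 \<or> b \<noteq> 0" "a * m + b * n = 0"
  proof (cases "m = 0")
    case True
    then show ?thesis using that[of 1 0] by simp
  next
    case False
    then show ?thesis using that[of n "- m"] by (simp add: mult.commute)
  qed
  have "imul a \<alpha> + imul b \<beta> \<in> G"
    using x(1) y(1) G add_subgroup_imul[OF G] by (simp add: add_subgroup_def)
  then obtain N where N: "N > 0" "imul N (imul a \<alpha> + imul b \<beta>) \<in> V" using torsion by blast
  let ?\<gamma> = "imul N (imul a \<alpha> + imul b \<beta>)"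
  have "imul (N * a) x + imul (N * b) y = const_value ?\<gamma>"
  proof (rule R_eq[OF R_add[OF R_imul[OF R(1)] R_imul[OF R(2)]] R_const_value[OF N(2)]])
    show "\<forall>\<^sub>F \<nu> in at_top. imul (N * a) (g \<nu>) + imul (N * b) (h \<nu>) = ?\<gamma>"
      using x(2) y(2)
    proof eventually_elim
      case (elim \<nu>)
      have "imul (N * a) (g \<nu>) + imul (N * b) (h \<nu>)
          = imul (N * (a * m + b * n)) (\<epsilon> \<nu>) + ?\<gamma>"
        unfolding elim by (simp add: imul_add_right imul_add_left distrib_left mult.assoc)
      then show ?case using ab(2) by simp
    qed
  qed
  then show ?thesis using ab(1) N by (intro exI[of _ "N * a"] exI[of _ "N * b"] exI[of _ ?\<gamma>]) auto
qed

sublocale group_extension V W const_value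
proof
  show "const_value x \<in> W" if "x \<in> V" for x using R_const_value[OF that] W_iff by blast
  show "const_value (x + y) = const_value x + const_value y" if "x \<in> V" "y \<in> V" for x y
    using that V
    by (intro R_eq[OF R_const_value R_add[OF R_const_value R_const_value]])
      (auto simp: add_subgroup_def)
qed (use V W const_value_le germ_rel_rank in auto)

lemma R_nonconst_pos:
  obtains x g m \<gamma> where "0 < m" "R x g" "\<gamma> \<in> G" "\<forall>\<^sub>F \<nu> in at_top. g \<nu> = imul m (\<epsilon> \<nu>) + \<gamma>"
proof -
  obtain x g m \<gamma> where x: "m \<noteq> 0" "R x g" "\<gamma> \<in> G" "\<forall>\<^sub>F \<nu> in at_top. g \<nu> = imul m (\<epsilon> \<nu>) + \<gamma>"
    using R_nonconst by blast
  show ?thesis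
  proof (cases "0 < m")
    case True
    then show ?thesis using x that by blast
  next
    case False
    have "\<forall>\<^sub>F \<nu> in at_top. - g \<nu> = imul (- m) (\<epsilon> \<nu>) + (- \<gamma>)"
      using x(4) by eventually_elim (simp add: imul_uminus_left)
    moreover have "- \<gamma> \<in> G" using x(3) G by (simp add: add_subgroup_def)
    moreover have "0 < - m" using False x(1) by simp
    ultimately show ?thesis using that R_uminus[OF x(2)] by blast
  qed
qed

section \<open>Rank jumps from infinitely large and infinitely small values\<close>

text \<open>A value with positive coefficient at \<open>\<epsilon>\<close> exceeds all of V, so the
  convex hull of V in W is proper, although it and W both contract to V.\<close>

lemma has_rank_Suc_of_cofinal:
  assumes "has_rank V n" and cof: "\<And>\<gamma>. \<gamma> \<in> V \<Longrightarrow> \<forall>\<^sub>F \<nu> in at_top. \<gamma> < \<epsilon> \<nu>"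
  shows "has_rank W (n + 1)"
proof -
  obtain x g m \<gamma> where x: "0 < m" "R x g" "\<gamma> \<in> G" "\<forall>\<^sub>F \<nu> in at_top. g \<nu> = imul m (\<epsilon> \<nu>) + \<gamma>"
    by (rule R_nonconst_pos)
  define A where "A = convex_hull_in W (const_value ` V)"
  have A: "A \<in> convex_subgroups W"
    unfolding A_def by (intro convex_hull_in_convex_subgroup W image_add_subgroup V) simp
  have gt: "const_value \<beta> < x" if \<beta>: "\<beta> \<in> V" for \<beta>
  proof -
    \<comment> \<open>The difference lies only in G, whereas \<open>cof\<close> speaks of V; a
      multiple of its absolute value is an upper bound inside V.\<close>
    have "mag (\<beta> - \<gamma>) \<in> G"
      using mag_cases[of "\<beta> - \<gamma>"] x(3) \<beta> VG G by (metis add_subgroup_def subsetD minus_diff_eq diff_conv_add_uminus)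
    then obtain N where N: "0 < N" "imul N (mag (\<beta> - \<gamma>)) \<in> V" using torsion by blast
    have le: "\<beta> - \<gamma> \<le> imul N (mag (\<beta> - \<gamma>))"
      using le_imul[OF N(1) mag_nonneg] le_mag order_trans by metis
    have nonneg: "0 \<le> imul N (mag (\<beta> - \<gamma>))"
      using le_imul[OF N(1) mag_nonneg] mag_nonneg order_trans by metis
    have "\<forall>\<^sub>F \<nu> in at_top. \<beta> < g \<nu>"
      using cof[OF N(2)] x(4)
    proof eventually_elim
      case (elim \<nu>)
      have "\<epsilon> \<nu> \<le> imul m (\<epsilon> \<nu>)" using elim(1) nonneg by (intro le_imul x(1)) simp
      then have "\<beta> - \<gamma> < imul m (\<epsilon> \<nu>)" using le elim(1) by (meson le_less_trans less_le_trans)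
      then show ?case unfolding elim(2) by (simp add: diff_less_eq)
    qed
    then show ?thesis using R_less[OF R_const_value[OF \<beta>] x(2)] by blast
  qed
  have "x \<notin> A"
  proof
    assume "x \<in> A"
    then obtain \<beta> where \<beta>: "\<beta> \<in> V" "mag x \<le> const_value \<beta>"
      by (auto simp: A_def convex_hull_in_def)
    then show False using gt[OF \<beta>(1)] order_trans[OF le_mag \<beta>(2)] by simp
  qed
  moreover have "x \<in> W" using x(2) W_iff by blast
  ultimately have "A \<subset> W" using convex_subgroups_D(2)[OF A] by blast
  moreover have "contraction A = contraction W"
    using contraction_hull[OF convex_subgroups_self[OF V]] j_in
    by (auto simp: A_def contraction_def)
  ultimately show ?thesis
    by (rule has_rank_jump[OF assms(1) A convex_subgroups_self[OF W]])
qed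

text \<open>A multiple of the gap between \<open>\<gamma>0\<close> and \<open>\<epsilon>\<close> is
  the germ of a positive value that is infinitely small over V. The hull of its multiples is nonzero
  but contracts to 0, as \<open>{0}\<close> does.\<close>

lemma has_rank_Suc_of_limit:
  assumes "has_rank V n" and \<gamma>0: "\<gamma>0 \<in> G"
    and below: "\<forall>\<^sub>F \<nu> in at_top. \<epsilon> \<nu> < \<gamma>0"
    and lim: "\<And>h. h \<in> G \<Longrightarrow> 0 < h \<Longrightarrow> \<forall>\<^sub>F \<nu> in at_top. \<gamma>0 - h < \<epsilon> \<nu>"
  shows "has_rank W (n + 1)"
proof -
  obtain x g m \<gamma> where x: "0 < m" "R x g" "\<gamma> \<in> G" "\<forall>\<^sub>F \<nu> in at_top. g \<nu> = imul m (\<epsilon> \<nu>) + \<gamma>"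
    by (rule R_nonconst_pos)
  \<comment> \<open>This constant is the would-be limit of g. The factor N makes it an element of V,
    hence a value in W from which N x can be subtracted; the germ left over is M times the
    gap.\<close>
  have "imul m \<gamma>0 + \<gamma> \<in> G" using add_subgroup_imul[OF G \<gamma>0] x(3) G by (auto simp: add_subgroup_def)
  then obtain N where N: "0 < N" "imul N (imul m \<gamma>0 + \<gamma>) \<in> V" using torsion by blast
  define y where "y = const_value (imul N (imul m \<gamma>0 + \<gamma>)) + - imul N x"
  define h where "h \<nu> = imul N (imul m \<gamma>0 + \<gamma>) + - imul N (g \<nu>)" for \<nu>
  define M where "M = N * m"
  have M: "0 < M" using N(1) x(1) by (simp add: M_def)
  have Ry: "R y h"
    unfolding y_def h_def by (intro R_add R_const_value R_uminus R_imul N(2) x(2))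
  have h: "\<forall>\<^sub>F \<nu> in at_top. h \<nu> = imul M (\<gamma>0 - \<epsilon> \<nu>)"
    using x(4) unfolding h_def M_def
    by eventually_elim
      (simp add: imul_add_right imul.scale_right_diff_distrib imul_uminus_right)
  have "\<forall>\<^sub>F \<nu> in at_top. 0 < h \<nu>"
    using h below by eventually_elim (simp add: imul_pos[OF M])
  then have y0: "0 < y" by (rule R_less[OF R_0 Ry])
  have small: "imul k y < const_value \<beta>" if \<beta>: "\<beta> \<in> V" "0 < \<beta>" for k \<beta>
  proof -
    \<comment> \<open>L is positive and exceeds k M for either sign of k. The gap eventually drops
      below the L-th part of \<open>\<beta>\<close>, which exists in G by divisibility.\<close>
    define L where "L = \<bar>k\<bar> * M + 1"
    have L: "0 < L" "k * M < L"
      using M mult_right_mono[of k "\<bar>k\<bar>" M] by (auto simp: L_def add_nonneg_pos)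
    obtain \<eta> where \<eta>: "\<eta> \<in> G" "imul L \<eta> = \<beta>" using divisible[OF _ L(1)] \<beta>(1) VG by blast
    have "0 < \<eta>" using imul_less_iff[OF L(1), of 0 \<eta>] \<eta>(2) \<beta>(2) by simp
    from lim[OF \<eta>(1) this] below h
    have "\<forall>\<^sub>F \<nu> in at_top. imul k (h \<nu>) < \<beta>"
    proof eventually_elim
      case (elim \<nu>)
      have pos: "0 < \<gamma>0 - \<epsilon> \<nu>" "\<gamma>0 - \<epsilon> \<nu> < \<eta>" using elim by (auto simp: algebra_simps)
      have "0 < imul (L - k * M) (\<gamma>0 - \<epsilon> \<nu>)" using L pos by (intro imul_pos) auto
      then have "imul (k * M) (\<gamma>0 - \<epsilon> \<nu>) < imul L (\<gamma>0 - \<epsilon> \<nu>)"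
        by (simp add: imul.scale_left_diff_distrib)
      also have "\<dots> < imul L \<eta>" using pos imul_less_iff[OF L(1)] by blast
      finally show ?case using elim(3) \<eta>(2) by simp
    qed
    then show ?thesis using R_less[OF R_imul[OF Ry] R_const_value[OF \<beta>(1)]] by blast
  qed
  let ?S = "range (\<lambda>k. imul k y)"
  have S: "add_subgroup ?S"
  proof -
    have "0 \<in> ?S" by (rule range_eqI[of _ _ 0]) simp
    moreover have "imul k y + imul l y \<in> ?S" for k l
      by (rule range_eqI[of _ _ "k + l"]) (simp add: imul_add_left)
    moreover have "- imul k y \<in> ?S" for k by (rule range_eqI[of _ _ "- k"]) simp
    ultimately show ?thesis unfolding add_subgroup_def by blast
  qed
  define B where "B = convex_hull_in W ?S"
  have B: "B \<in> convex_subgroups W"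
    unfolding B_def by (intro convex_hull_in_convex_subgroup W S)
  have "mag y \<le> imul 1 y" using y0 order_trans[of "- y" 0 y] by (simp add: mag_le_iff minus_le_iff)
  moreover have "y \<in> W" unfolding W_iff by (rule exI, rule Ry)
  ultimately have "y \<in> B" unfolding B_def convex_hull_in_def by blast
  have Z: "{0} \<in> convex_subgroups W"
    using W by (auto simp: convex_subgroups_def add_subgroup_def)
  have "\<gamma> = 0" if \<gamma>: "\<gamma> \<in> V" "const_value \<gamma> \<in> B" for \<gamma>
  proof (rule ccontr)
    assume "\<gamma> \<noteq> 0"
    then have pos: "0 < mag \<gamma>" using mag_nonneg[of \<gamma>] mag_eq_0_iff[of \<gamma>] by auto
    obtain k where "mag (const_value \<gamma>) \<le> imul k y"
      using \<gamma>(2) by (auto simp: B_def convex_hull_in_def)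
    moreover have "imul k y < const_value (mag \<gamma>)" by (intro small V_mag \<gamma>(1) pos)
    ultimately show False using j_mag[OF \<gamma>(1)] by simp
  qed
  then have "contraction {0} = contraction B"
    using V convex_subgroups_D(3)[OF B] j_less[of _ 0] j_less[of 0] unfolding contraction_def add_subgroup_def
    by auto (metis less_irrefl neqE)
  then show ?thesis
    using has_rank_jump[OF assms(1) Z B] convex_subgroups_D(3)[OF B] \<open>y \<in> B\<close> y0 by blast
qed

text \<open>
  As \<open>G\<close> is divisible and \<open>s \<notin> \<rho> ` G\<close>, no nontrivial \<open>m * s + \<rho> \<gamma>\<close> vanishes; hence \<open>W\<close> is archimedean.
\<close>

lemma not_has_rank_2:
  fixes \<rho> :: "'g \<Rightarrow> real"
  assumes \<rho>_add: "\<And>x y. x \<in> G \<Longrightarrow> y \<in> G \<Longrightarrow> \<rho> (x + y) = \<rho> x + \<rho> y"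
    and \<rho>_less: "\<And>x y. x \<in> G \<Longrightarrow> y \<in> G \<Longrightarrow> x < y \<longleftrightarrow> \<rho> x < \<rho> y"
    and \<epsilon>_G: "\<forall>\<^sub>F \<nu> in at_top. \<epsilon> \<nu> \<in> G"
    and \<epsilon>_lim: "((\<lambda>\<nu>. \<rho> (\<epsilon> \<nu>)) \<longlongrightarrow> s) at_top"
    and s: "s \<notin> \<rho> ` G"
  shows "\<not> has_rank W 2"
proof -
  have \<rho>_0: "\<rho> 0 = 0" using \<rho>_add[of 0 0] G by (simp add: add_subgroup_def)
  have \<rho>_uminus: "\<rho> (- x) = - \<rho> x" if "x \<in> G" for x
    using \<rho>_add[OF that, of "- x"] that G \<rho>_0 by (simp add: add_subgroup_def)
  have \<rho>_imul: "\<rho> (imul k x) = of_int k * \<rho> x" if x: "x \<in> G" for k x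
  proof (induction k rule: int_induct[where k = 0])
    case base
    then show ?case using \<rho>_0 by simp
  next
    case (step1 i)
    then show ?case
      using \<rho>_add[OF add_subgroup_imul[OF G x] x, of i] by (simp add: imul_add_left algebra_simps)
  next
    case (step2 i)
    have "imul (i - 1) x = imul i x + - x" by (simp add: imul.scale_left_diff_distrib)
    then show ?case
      using step2 \<rho>_add[OF add_subgroup_imul[OF G x], of "- x" i] \<rho>_uminus[OF x] x G
      by (simp add: add_subgroup_def algebra_simps)
  qed
  have lim: "\<exists>l. ((\<lambda>\<nu>. \<rho> (g \<nu>)) \<longlongrightarrow> l) at_top \<and> (\<forall>\<^sub>F \<nu> in at_top. g \<nu> \<in> G) \<and> (0 < x \<longrightarrow> 0 < l)"
    if R: "R x g" for x g
  proof -
    obtain m \<gamma> where x: "\<gamma> \<in> G" "\<forall>\<^sub>F \<nu> in at_top. g \<nu> = imul m (\<epsilon> \<nu>) + \<gamma>"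
      using R_germ[OF R] by blast
    have gG: "\<forall>\<^sub>F \<nu> in at_top. g \<nu> \<in> G"
      using x(2) \<epsilon>_G
      by eventually_elim (use x(1) G add_subgroup_imul[OF G] in \<open>simp add: add_subgroup_def\<close>)
    have "\<forall>\<^sub>F \<nu> in at_top. of_int m * \<rho> (\<epsilon> \<nu>) + \<rho> \<gamma> = \<rho> (g \<nu>)"
      using x(2) \<epsilon>_G
      by eventually_elim (use x(1) in \<open>simp add: \<rho>_add add_subgroup_imul[OF G] \<rho>_imul\<close>)
    moreover have "((\<lambda>\<nu>. of_int m * \<rho> (\<epsilon> \<nu>) + \<rho> \<gamma>) \<longlongrightarrow> of_int m * s + \<rho> \<gamma>) at_top"
      by (intro tendsto_intros \<epsilon>_lim)
    ultimately have l: "((\<lambda>\<nu>. \<rho> (g \<nu>)) \<longlongrightarrow> of_int m * s + \<rho> \<gamma>) at_top"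
      by (rule Lim_transform_eventually[rotated])
    have "0 < of_int m * s + \<rho> \<gamma>" if "0 < x"
    proof -
      have "\<forall>\<^sub>F \<nu> in at_top. 0 \<le> g \<nu>" using R_nonneg[OF R] less_imp_le[OF that] by blast
      then have "\<forall>\<^sub>F \<nu> in at_top. 0 \<le> \<rho> (g \<nu>)"
        using gG
      proof eventually_elim
        case (elim \<nu>)
        then show ?case using \<rho>_less[of "g \<nu>" 0] G \<rho>_0 by (auto simp: add_subgroup_def not_less[symmetric])
      qed
      then have ge: "0 \<le> of_int m * s + \<rho> \<gamma>"
        using tendsto_lowerbound[OF l] at_top_neq_bot by blast
      \<comment> \<open>With m nonzero, a zero limit would make s the image of the m-th part of -
        \<open>\<gamma>\<close>; with m = 0 it would make \<open>\<gamma>\<close>, and then x,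
        zero.\<close>
      moreover have "of_int m * s + \<rho> \<gamma> \<noteq> 0"
      proof
        assume 0: "of_int m * s + \<rho> \<gamma> = 0"
        have "\<exists>h\<in>G. imul m h = - \<gamma>" if "m \<noteq> 0"
        proof (cases "0 < m")
          case True
          then show ?thesis using divisible[of "- \<gamma>" m] x(1) G by (auto simp: add_subgroup_def)
        next
          case False
          then have "0 < - m" using that by simp
          then obtain h where "h \<in> G" "imul (- m) h = \<gamma>" using divisible x(1) by blast
          then show ?thesis by (auto simp: imul_uminus_left intro!: bexI[of _ h])
        qed
        then have "m = 0" using 0 s \<rho>_imul \<rho>_uminus[OF x(1)]
          by (metis add.commute add_eq_0_iff imageI mult_left_cancel of_int_eq_0_iff)
        then have "\<rho> \<gamma> = \<rho> 0" using 0 \<rho>_0 by simp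
        then have "\<gamma> = 0" using \<rho>_less[of \<gamma> 0] \<rho>_less[of 0 \<gamma>] x(1) G
          by (auto simp: add_subgroup_def neq_iff)
        then have "x = 0" using R_eq[OF R R_0] x(2) \<open>m = 0\<close> by simp
        then show False using \<open>0 < x\<close> by simp
      qed
      ultimately show ?thesis by simp
    qed
    then show ?thesis using l gG by blast
  qed
  have arch: "\<exists>k. y \<le> imul k x" if xy: "x \<in> W" "y \<in> W" "0 < x" for x y
  proof -
    obtain g h where R: "R x g" "R y h" using xy(1,2) W_iff by blast
    obtain l where l: "((\<lambda>\<nu>. \<rho> (g \<nu>)) \<longlongrightarrow> l) at_top" "\<forall>\<^sub>F \<nu> in at_top. g \<nu> \<in> G" "0 < l"
      using lim[OF R(1)] xy(3) by blast
    obtain l' where l': "((\<lambda>\<nu>. \<rho> (h \<nu>)) \<longlongrightarrow> l') at_top" "\<forall>\<^sub>F \<nu> in at_top. h \<nu> \<in> G"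
      using lim[OF R(2)] by blast
    obtain n where "l' < real n * l" using reals_Archimedean3[OF l(3)] by blast
    then have n: "0 < of_int (int n) * l - l'" by simp
    have "((\<lambda>\<nu>. of_int (int n) * \<rho> (g \<nu>) - \<rho> (h \<nu>)) \<longlongrightarrow> of_int (int n) * l - l') at_top"
      by (intro tendsto_intros l(1) l'(1))
    from order_tendstoD(1)[OF this n]
    have "\<forall>\<^sub>F \<nu> in at_top. h \<nu> < imul (int n) (g \<nu>)"
      using l(2) l'(2)
    proof eventually_elim
      case (elim \<nu>)
      then show ?case using \<rho>_less[of "h \<nu>" "imul (int n) (g \<nu>)"] add_subgroup_imul[OF G elim(2)] \<rho>_imul[OF elim(2)] by simp
    qed
    then have "y < imul (int n) x" by (rule R_less[OF R(2) R_imul[OF R(1)]])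
    then show ?thesis by (auto intro: less_imp_le)
  qed
  \<comment> \<open>By archimedeanness a nonzero convex subgroup is everything, whereas rank 2 would
    require three convex subgroups.\<close>
  have "convex_subgroups W \<subseteq> {{0}, W}"
  proof
    fix C assume C: "C \<in> convex_subgroups W"
    note D = convex_subgroups_D[OF C]
    have "C = W" if "C \<noteq> {0}"
    proof -
      obtain x where x: "x \<in> C" "x \<noteq> 0" using \<open>C \<noteq> {0}\<close> D(3) by blast
      have mx: "mag x \<in> C" "0 < mag x"
        using mag_cases[of x] x D(5) mag_nonneg[of x] mag_eq_0_iff[of x] by (auto simp: less_le)
      have "y \<in> C" if y: "y \<in> W" for y
      proof -
        have "mag y \<in> W" using y W mag_cases[of y] by (auto simp: add_subgroup_def)
        then obtain k where k: "mag y \<le> imul k (mag x)" using arch[of "mag x" "mag y"] mx D(2) by blast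
        then have "mag y \<le> mag (imul k (mag x))" using le_mag order_trans by blast
        then show ?thesis using D(7)[OF D(6)[OF mx(1)] y] by blast
      qed
      then show ?thesis using D(2) by blast
    qed
    then show "C \<in> {{0}, W}" by blast
  qed
  then have "card (convex_subgroups W) \<le> card {{0}, W}" by (intro card_mono) auto
  also have "\<dots> \<le> 2" by (simp add: card_insert_if)
  finally show ?thesis by (simp add: has_rank_iff[OF W])
qed

end

section \<open>The value group of \<open>v\<^sub>E\<close>\<close>

text \<open>Common interface of the two kinds of sequences: \<open>\<sigma>\<close> = 1 and
  \<open>\<epsilon>\<close> the gauge, or \<open>\<sigma>\<close> = -1 and \<open>\<epsilon>\<close>
  the negative gauge. In either case \<open>\<epsilon>\<close> eventually increases and
  \<open>imul \<sigma> (\<epsilon> \<nu>)\<close> is the gauge.\<close>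

locale seq_val = closure_val v vbar + E: krull_val vE
  for v :: "'a::field \<Rightarrow> 'g::linordered_ab_group_add extended"
    and vbar :: "'a alg_closure \<Rightarrow> 'g extended"
    and vE :: "'a poly fract \<Rightarrow> 'h::linordered_ab_group_add extended" +
  fixes z :: "'i::{wellorder,no_top} \<Rightarrow> 'a" and \<epsilon> :: "'i \<Rightarrow> 'g" and \<sigma> :: int
  assumes ring: "valuation_ring vE = seq_ring v z"
    and alternative: "\<And>a. (\<exists>c\<in>value_group vbar. \<forall>\<^sub>F \<nu> in at_top. vbar (to_ac (z \<nu>) - a) = Fin c) \<or>
      (\<forall>\<^sub>F \<nu> in at_top. vbar (to_ac (z \<nu>) - a) = Fin (imul \<sigma> (\<epsilon> \<nu>)))"
    and algebraic: "algebraic_type v z"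
begin

abbreviation "G \<equiv> value_group vbar"

text \<open>Each linear factor contributes a constant of G or the gauge; m is
  \<open>\<sigma>\<close> times the number of roots, with multiplicity, that contribute the
  gauge.\<close>

lemma closure_poly_germ:
  assumes "p \<noteq> 0"
  shows "\<exists>m. \<exists>\<gamma>\<in>G. \<forall>\<^sub>F \<nu> in at_top. vbar (poly p (to_ac (z \<nu>))) = Fin (imul m (\<epsilon> \<nu>) + \<gamma>)"
proof -
  note G = L.add_subgroup_value_group
  obtain A where A: "p = smult (lead_coeff p) (\<Prod>a\<in>#A. [:- a, 1:])"
    using alg_closed_imp_factorization[OF assms] by blast
  have prod: "\<exists>m. \<exists>\<gamma>\<in>G. \<forall>\<^sub>F \<nu> in at_top.
    vbar (poly (\<Prod>a\<in>#A. [:- a, 1:]) (to_ac (z \<nu>))) = Fin (imul m (\<epsilon> \<nu>) + \<gamma>)"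
  proof (induction A)
    case empty
    have "0 \<in> G" using G by (simp add: add_subgroup_def)
    moreover have "vbar 1 = Fin 0" by (simp add: L.v_eq_Fin)
    ultimately show ?case by (auto intro!: exI[of _ 0] bexI[of _ 0])
  next
    case (add a A)
    then obtain m \<gamma> where \<gamma>: "\<gamma> \<in> G"
      "\<forall>\<^sub>F \<nu> in at_top. vbar (poly (\<Prod>a\<in>#A. [:- a, 1:]) (to_ac (z \<nu>))) = Fin (imul m (\<epsilon> \<nu>) + \<gamma>)"
      by blast
    have factor: "poly (\<Prod>a\<in>#add_mset a A. [:- a, 1:]) x = (x - a) * poly (\<Prod>a\<in>#A. [:- a, 1:]) x" for x
      by (simp add: algebra_simps)
    from alternative[of a] show ?case
    proof
      assume "\<exists>c\<in>G. \<forall>\<^sub>F \<nu> in at_top. vbar (to_ac (z \<nu>) - a) = Fin c"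
      then obtain c where c: "c \<in> G" "\<forall>\<^sub>F \<nu> in at_top. vbar (to_ac (z \<nu>) - a) = Fin c" by blast
      have "\<forall>\<^sub>F \<nu> in at_top. vbar (poly (\<Prod>a\<in>#add_mset a A. [:- a, 1:]) (to_ac (z \<nu>)))
          = Fin (imul m (\<epsilon> \<nu>) + (c + \<gamma>))"
        using \<gamma>(2) c(2) unfolding factor by eventually_elim (simp add: L.v_mult ac_simps)
      moreover have "c + \<gamma> \<in> G" using c(1) \<gamma>(1) G by (simp add: add_subgroup_def)
      ultimately show ?thesis by blast
    next
      assume *: "\<forall>\<^sub>F \<nu> in at_top. vbar (to_ac (z \<nu>) - a) = Fin (imul \<sigma> (\<epsilon> \<nu>))"
      have "\<forall>\<^sub>F \<nu> in at_top. vbar (poly (\<Prod>a\<in>#add_mset a A. [:- a, 1:]) (to_ac (z \<nu>)))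
          = Fin (imul (\<sigma> + m) (\<epsilon> \<nu>) + \<gamma>)"
        using \<gamma>(2) * unfolding factor
        by eventually_elim (simp add: L.v_mult imul_add_left ac_simps)
      then show ?thesis using \<gamma>(1) by blast
    qed
  qed
  then obtain m \<gamma> where \<gamma>: "\<gamma> \<in> G"
    "\<forall>\<^sub>F \<nu> in at_top. vbar (poly (\<Prod>a\<in>#A. [:- a, 1:]) (to_ac (z \<nu>))) = Fin (imul m (\<epsilon> \<nu>) + \<gamma>)"
    by blast
  have lead: "lead_coeff p \<noteq> 0" using assms by simp
  have "\<forall>\<^sub>F \<nu> in at_top. vbar (poly p (to_ac (z \<nu>)))
      = Fin (imul m (\<epsilon> \<nu>) + (fval vbar (lead_coeff p) + \<gamma>))"
    using \<gamma>(2)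
  proof eventually_elim
    case (elim \<nu>)
    have "vbar (poly p (to_ac (z \<nu>)))
        = vbar (lead_coeff p * poly (\<Prod>a\<in>#A. [:- a, 1:]) (to_ac (z \<nu>)))"
      by (subst A) (simp only: poly_smult)
    then show ?case using elim L.v_eq_Fin[OF lead] by (simp add: L.v_mult ac_simps)
  qed
  moreover have "fval vbar (lead_coeff p) + \<gamma> \<in> G"
    using \<gamma>(1) L.fval_in[OF lead] G by (simp add: add_subgroup_def)
  ultimately show ?thesis by blast
qed

lemma poly_germ:
  assumes "f \<noteq> 0"
  obtains m \<gamma> where "\<gamma> \<in> G"
    "\<forall>\<^sub>F \<nu> in at_top. v (poly f (z \<nu>)) = Fin (imul m (\<epsilon> \<nu>) + \<gamma>)"
proof -
  have "map_poly to_ac f \<noteq> 0" using assms map_poly_to_ac_eq_0_iff by blast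
  from closure_poly_germ[OF this] show ?thesis
    unfolding poly_map_to_ac ext using that by blast
qed

lemma eventually_poly_neq_0:
  assumes "f \<noteq> 0"
  shows "\<forall>\<^sub>F \<nu> in at_top. poly f (z \<nu>) \<noteq> 0"
proof -
  obtain m \<gamma> where "\<forall>\<^sub>F \<nu> in at_top. v (poly f (z \<nu>)) = Fin (imul m (\<epsilon> \<nu>) + \<gamma>)"
    using poly_germ[OF assms] by blast
  then show ?thesis by eventually_elim auto
qed

text \<open>Only eventual equality is asked for, so any representative of a germ is accepted and the
  default of \<open>fval\<close> at zeros of p and q stays invisible.\<close>

definition germ_of :: "'h \<Rightarrow> ('i \<Rightarrow> 'g) \<Rightarrow> bool" where
  "germ_of x g \<longleftrightarrow> (\<exists>p q. p \<noteq> 0 \<and> q \<noteq> 0 \<and> fval vE (Fraction_Field.Fract p q) = x \<and>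
     (\<forall>\<^sub>F \<nu> in at_top. g \<nu> = fval v (poly p (z \<nu>)) - fval v (poly q (z \<nu>))))"

lemma germ_ofI:
  assumes "p \<noteq> 0" "q \<noteq> 0" "fval vE (Fraction_Field.Fract p q) = x"
    "\<forall>\<^sub>F \<nu> in at_top. g \<nu> = fval v (poly p (z \<nu>)) - fval v (poly q (z \<nu>))"
  shows "germ_of x g"
  unfolding germ_of_def using assms by blast

lemma Fract_neq_0: "p \<noteq> 0 \<Longrightarrow> q \<noteq> 0 \<Longrightarrow> Fraction_Field.Fract p q \<noteq> 0" for p q :: "'a poly"
  by (simp add: Zero_fract_def eq_fract)

lemma value_group_vE_iff: "x \<in> value_group vE \<longleftrightarrow> (\<exists>g. germ_of x g)"
proof
  assume "x \<in> value_group vE"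
  then obtain \<phi> where \<phi>: "\<phi> \<noteq> 0" "fval vE \<phi> = x" using E.value_group_iff by blast
  obtain p q where pq: "\<phi> = Fraction_Field.Fract p q" "p \<noteq> 0" "q \<noteq> 0"
    using \<phi>(1) by (cases \<phi> rule: Fract_cases_nonzero) auto
  have "germ_of x (\<lambda>\<nu>. fval v (poly p (z \<nu>)) - fval v (poly q (z \<nu>)))"
    using \<phi>(2) pq by (intro germ_ofI) auto
  then show "\<exists>g. germ_of x g" by (rule exI[of "germ_of x"])
next
  assume "\<exists>g. germ_of x g"
  then show "x \<in> value_group vE"
    unfolding germ_of_def using E.fval_in[OF Fract_neq_0] by blast
qed

lemma germ_of_add:
  assumes "germ_of x g" "germ_of y h"
  shows "germ_of (x + y) (\<lambda>\<nu>. g \<nu> + h \<nu>)"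
proof -
  obtain p q where pq: "p \<noteq> 0" "q \<noteq> 0" "fval vE (Fraction_Field.Fract p q) = x"
    "\<forall>\<^sub>F \<nu> in at_top. g \<nu> = fval v (poly p (z \<nu>)) - fval v (poly q (z \<nu>))"
    using assms(1) unfolding germ_of_def by blast
  obtain r s where rs: "r \<noteq> 0" "s \<noteq> 0" "fval vE (Fraction_Field.Fract r s) = y"
    "\<forall>\<^sub>F \<nu> in at_top. h \<nu> = fval v (poly r (z \<nu>)) - fval v (poly s (z \<nu>))"
    using assms(2) unfolding germ_of_def by blast
  show ?thesis
  proof (rule germ_ofI)
    show "p * r \<noteq> 0" "q * s \<noteq> 0" using pq rs by auto
    show "fval vE (Fraction_Field.Fract (p * r) (q * s)) = x + y"
      using E.fval_mult[OF Fract_neq_0[OF pq(1,2)] Fract_neq_0[OF rs(1,2)]] pq(3) rs(3) by simp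
    show "\<forall>\<^sub>F \<nu> in at_top. g \<nu> + h \<nu> = fval v (poly (p * r) (z \<nu>)) - fval v (poly (q * s) (z \<nu>))"
      using pq(4) rs(4) eventually_poly_neq_0[OF pq(1)] eventually_poly_neq_0[OF pq(2)]
        eventually_poly_neq_0[OF rs(1)] eventually_poly_neq_0[OF rs(2)]
      by eventually_elim (simp add: K.fval_mult)
  qed
qed

lemma germ_of_uminus:
  assumes "germ_of x g"
  shows "germ_of (- x) (\<lambda>\<nu>. - g \<nu>)"
proof -
  obtain p q where pq: "p \<noteq> 0" "q \<noteq> 0" "fval vE (Fraction_Field.Fract p q) = x"
    "\<forall>\<^sub>F \<nu> in at_top. g \<nu> = fval v (poly p (z \<nu>)) - fval v (poly q (z \<nu>))"
    using assms(1) unfolding germ_of_def by blast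
  show ?thesis
  proof (rule germ_ofI)
    show "fval vE (Fraction_Field.Fract q p) = - x"
      using E.fval_inverse[OF Fract_neq_0[OF pq(1,2)]] pq(3) by simp
    show "\<forall>\<^sub>F \<nu> in at_top. - g \<nu> = fval v (poly q (z \<nu>)) - fval v (poly p (z \<nu>))"
      using pq(4) by eventually_elim simp
  qed (use pq in auto)
qed

text \<open>Membership in \<open>seq_ring\<close> may be witnessed by another fraction r / s; cross
  multiplication transfers the condition to p / q at all large indices.\<close>

lemma germ_of_nonneg:
  assumes "germ_of x g"
  shows "0 \<le> x \<longleftrightarrow> (\<forall>\<^sub>F \<nu> in at_top. 0 \<le> g \<nu>)"
proof -
  obtain p q where pq: "p \<noteq> 0" "q \<noteq> 0" "fval vE (Fraction_Field.Fract p q) = x"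
    "\<forall>\<^sub>F \<nu> in at_top. g \<nu> = fval v (poly p (z \<nu>)) - fval v (poly q (z \<nu>))"
    using assms(1) unfolding germ_of_def by blast
  have nz: "\<forall>\<^sub>F \<nu> in at_top. poly p (z \<nu>) \<noteq> 0" "\<forall>\<^sub>F \<nu> in at_top. poly q (z \<nu>) \<noteq> 0"
    using eventually_poly_neq_0 pq(1,2) by auto
  have val: "\<forall>\<^sub>F \<nu> in at_top. v (poly p (z \<nu>) / poly q (z \<nu>)) = Fin (g \<nu>)"
    using nz pq(4) by eventually_elim (simp add: K.v_eq_Fin K.fval_divide)
  have "0 \<le> x \<longleftrightarrow> Fraction_Field.Fract p q \<in> seq_ring v z"
    unfolding ring[symmetric] valuation_ring_def
    using E.v_eq_Fin[OF Fract_neq_0[OF pq(1,2)]] pq(3) by (simp add: zero_extended_def)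
  also have "\<dots> \<longleftrightarrow> (\<forall>\<^sub>F \<nu> in at_top. 0 \<le> g \<nu>)"
  proof
    assume "Fraction_Field.Fract p q \<in> seq_ring v z"
    then obtain r s where rs: "Fraction_Field.Fract p q = Fraction_Field.Fract r s" "s \<noteq> 0"
      "\<forall>\<^sub>F \<nu> in at_top. poly s (z \<nu>) \<noteq> 0 \<and> 0 \<le> v (poly r (z \<nu>) / poly s (z \<nu>))"
      unfolding seq_ring_def by blast
    have "p * s = r * q" using rs(1,2) pq(2) by (simp add: eq_fract)
    then have cross: "poly p x * poly s x = poly r x * poly q x" for x by (metis poly_mult)
    show "\<forall>\<^sub>F \<nu> in at_top. 0 \<le> g \<nu>"
      using rs(3) nz(2) val
    proof eventually_elim
      case (elim \<nu>)
      have "poly p (z \<nu>) / poly q (z \<nu>) = poly r (z \<nu>) / poly s (z \<nu>)"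
        using elim cross[of "z \<nu>"] by (simp add: frac_eq_eq)
      then show ?case using elim by (simp add: zero_extended_def)
    qed
  next
    assume "\<forall>\<^sub>F \<nu> in at_top. 0 \<le> g \<nu>"
    then have "\<forall>\<^sub>F \<nu> in at_top. poly q (z \<nu>) \<noteq> 0 \<and> 0 \<le> v (poly p (z \<nu>) / poly q (z \<nu>))"
      using nz(2) val by eventually_elim (simp add: zero_extended_def)
    then show "Fraction_Field.Fract p q \<in> seq_ring v z" unfolding seq_ring_def using pq(2) by blast
  qed
  finally show ?thesis .
qed

lemma germ_of_const:
  assumes "\<gamma> \<in> value_group v"
  shows "\<exists>x. germ_of x (\<lambda>_. \<gamma>)"
proof -
  obtain c where c: "c \<noteq> 0" "fval v c = \<gamma>" using assms K.value_group_iff by blast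
  have "germ_of (fval vE (Fraction_Field.Fract [:c:] 1)) (\<lambda>_. \<gamma>)"
    by (rule germ_ofI) (use c in auto)
  then show ?thesis by blast
qed

lemma germ_of_germ:
  assumes "germ_of x g"
  shows "\<exists>m. \<exists>\<gamma>\<in>G. \<forall>\<^sub>F \<nu> in at_top. g \<nu> = imul m (\<epsilon> \<nu>) + \<gamma>"
proof -
  obtain p q where pq: "p \<noteq> 0" "q \<noteq> 0"
    "\<forall>\<^sub>F \<nu> in at_top. g \<nu> = fval v (poly p (z \<nu>)) - fval v (poly q (z \<nu>))"
    using assms(1) unfolding germ_of_def by blast
  obtain m \<alpha> where \<alpha>: "\<alpha> \<in> G" "\<forall>\<^sub>F \<nu> in at_top. v (poly p (z \<nu>)) = Fin (imul m (\<epsilon> \<nu>) + \<alpha>)"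
    using poly_germ[OF pq(1)] by blast
  obtain n \<beta> where \<beta>: "\<beta> \<in> G" "\<forall>\<^sub>F \<nu> in at_top. v (poly q (z \<nu>)) = Fin (imul n (\<epsilon> \<nu>) + \<beta>)"
    using poly_germ[OF pq(2)] by blast
  have "\<forall>\<^sub>F \<nu> in at_top. g \<nu> = imul (m - n) (\<epsilon> \<nu>) + (\<alpha> + - \<beta>)"
    using pq(3) \<alpha>(2) \<beta>(2)
    by eventually_elim (simp add: K.v_eq_Fin_iff imul.scale_left_diff_distrib)
  moreover have "\<alpha> + - \<beta> \<in> G"
    using \<alpha>(1) \<beta>(1) L.add_subgroup_value_group unfolding add_subgroup_def by blast
  ultimately show ?thesis by blast
qed

text \<open>For a polynomial witnessing algebraic type, coefficient m = 0 would make the values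
  eventually constant.\<close>

lemma germ_of_nonconst:
  "\<exists>x g m. m \<noteq> 0 \<and> germ_of x g \<and> (\<exists>\<gamma>\<in>G. \<forall>\<^sub>F \<nu> in at_top. g \<nu> = imul m (\<epsilon> \<nu>) + \<gamma>)"
proof -
  obtain f :: "'a poly" where f: "\<nexists>c. \<forall>\<^sub>F \<nu> in at_top. v (poly f (z \<nu>)) = c"
    using algebraic unfolding algebraic_type_def by blast
  then have "f \<noteq> 0" by auto
  obtain m \<gamma> where \<gamma>: "\<gamma> \<in> G" "\<forall>\<^sub>F \<nu> in at_top. v (poly f (z \<nu>)) = Fin (imul m (\<epsilon> \<nu>) + \<gamma>)"
    using poly_germ[OF \<open>f \<noteq> 0\<close>] by blast
  have "m \<noteq> 0" using f \<gamma>(2) by auto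
  moreover have "germ_of (fval vE (Fraction_Field.Fract f 1)) (\<lambda>\<nu>. imul m (\<epsilon> \<nu>) + \<gamma>)"
  proof (rule germ_ofI)
    show "\<forall>\<^sub>F \<nu> in at_top. imul m (\<epsilon> \<nu>) + \<gamma> = fval v (poly f (z \<nu>)) - fval v (poly 1 (z \<nu>))"
      using \<gamma>(2) by eventually_elim (simp add: K.v_eq_Fin_iff)
  qed (use \<open>f \<noteq> 0\<close> in auto)
  ultimately show ?thesis using \<gamma>(1)
    by (intro exI[of _ "fval vE (Fraction_Field.Fract f 1)"] exI[of _ "\<lambda>\<nu>. imul m (\<epsilon> \<nu>) + \<gamma>"]
        exI[of _ m] conjI bexI[of _ \<gamma>] always_eventually allI refl)
qed

sublocale germ_values "value_group v" "value_group vbar" "value_group vE" germ_of \<epsilon>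
  by unfold_locales
    (fact K.add_subgroup_value_group L.add_subgroup_value_group value_group_subset
      value_group_torsion value_group_divisible value_group_vE_iff germ_of_add germ_of_uminus
      germ_of_nonneg germ_of_const germ_of_germ germ_of_nonconst)+

end

section \<open>Suprema and infima in the lexicographic cube\<close>

lemma lex_cube_simps:
  "carrier (lex_cube n) = {..<n} \<rightarrow>\<^sub>E UNIV"
  "x \<sqsubseteq>\<^bsub>lex_cube n\<^esub> y \<longleftrightarrow> x = y \<or> less_fun x y"
  by (simp_all add: lex_cube_def)

lemma lex_cube_undefined: "x \<in> carrier (lex_cube n) \<Longrightarrow> \<not> k < n \<Longrightarrow> x k = undefined"
  unfolding lex_cube_simps by (auto intro: PiE_arb)

text \<open>Points of the cube agree outside of \<open>{..<n}\<close>, so they differ in finitely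
  many places only, as trichotomy of \<open>less_fun\<close> demands.\<close>

lemma lex_cube_less_fun_linear:
  assumes "x \<in> carrier (lex_cube n)" "y \<in> carrier (lex_cube n)"
  shows "less_fun x y \<or> x = y \<or> less_fun y x"
proof (rule less_fun_trichotomy)
  have "{k. x k \<noteq> y k} \<subseteq> {..<n}"
    using lex_cube_undefined[OF assms(1)] lex_cube_undefined[OF assms(2)] by force
  then show "finite {k. x k \<noteq> y k}" by (rule finite_subset) simp
qed

text \<open>
  The \<open>i\<close>-th coordinate of the supremum is the supremum of the \<open>i\<close>-th coordinates of those points
  that agree with the supremum in the previous coordinates (which is \<open>-\<infinity>\<close> if there are none).
\<close>

lemma lex_cube_ex_sup:
  assumes A: "A \<subseteq> carrier (lex_cube n)"
  shows "\<exists>s. least (lex_cube n) s (Upper (lex_cube n) A)"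
proof -
  define F where "F s i = (SUP x\<in>{x\<in>A. \<forall>j<i. x j = s j}. x i)" for s :: "nat \<Rightarrow> ereal" and i
  have "\<exists>s. \<forall>i. s i = F s i"
  proof (intro exI allI)
    fix i
    \<comment> \<open>\<open>F s i\<close> reads s only at indices below i, so well-founded
      recursion provides a fixpoint.\<close>
    have "adm_wf less_than F"
      unfolding adm_wf_def F_def by (auto intro!: arg_cong[where f = Sup] image_cong)
    from wfrec_fixpoint[OF wf_less_than this] show "wfrec less_than F i = F (wfrec less_than F) i"
      by (rule fun_cong)
  qed
  then obtain s where s: "\<And>i. s i = F s i" by blast
  define t where "t = restrict s {..<n}"
  have t: "t \<in> carrier (lex_cube n)" by (simp add: t_def lex_cube_simps)
  have ts: "t i = s i" if "i < n" for i using that by (simp add: t_def)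
  have witness: "k < n" if "x \<in> carrier (lex_cube n)" "x k \<noteq> t k" for x k
    using that(2) lex_cube_undefined[OF t, of k] lex_cube_undefined[OF that(1), of k]
    by (cases "k < n") simp_all
  have upper: "\<not> less_fun t x" if x: "x \<in> A" for x
  proof
    assume "less_fun t x"
    then obtain k where k: "t k < x k" "\<And>j. j < k \<Longrightarrow> t j = x j" by (auto elim: less_funE)
    have kn: "k < n" using k(1) A x by (intro witness[of x]) auto
    have "x k \<le> F s k"
      unfolding F_def using x k(2) kn ts by (intro SUP_upper) (simp add: order_less_trans)
    then show False using k(1) s[of k] ts[OF kn] by simp
  qed
  have least: "\<not> less_fun u t"
    if u: "u \<in> carrier (lex_cube n)" and ub: "\<And>x. x \<in> A \<Longrightarrow> x = u \<or> less_fun x u" for u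
  proof
    assume "less_fun u t"
    then obtain k where k: "u k < t k" "\<And>j. j < k \<Longrightarrow> u j = t j" by (auto elim: less_funE)
    have kn: "k < n" using k(1) u by (intro witness[of u]) auto
    have "u k < F s k" using k(1) s[of k] ts[OF kn] by simp
    \<comment> \<open>Below the supremum defining \<open>F s k\<close> there is room for a point of
      A that agrees with s before k and exceeds u at k.\<close>
    then obtain x where x: "x \<in> A" "\<And>j. j < k \<Longrightarrow> x j = s j" "u k < x k"
      unfolding F_def less_SUP_iff by auto
    have "less_fun u x"
      by (rule less_funI, rule exI[of _ k]) (use x k kn ts in auto)
    then show False using ub[OF x(1)] less_fun_asym less_fun_irrefl by blast
  qed
  have "least (lex_cube n) t (Upper (lex_cube n) A)"
  proof (rule least_UpperI)
    show "x \<sqsubseteq>\<^bsub>lex_cube n\<^esub> t" if "x \<in> A" for x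
      using upper[OF that] lex_cube_less_fun_linear[OF t, of x] A that
      unfolding lex_cube_simps(2) by blast
    show "t \<sqsubseteq>\<^bsub>lex_cube n\<^esub> u" if "u \<in> Upper (lex_cube n) A" for u
    proof -
      have u: "u \<in> carrier (lex_cube n)" "\<And>x. x \<in> A \<Longrightarrow> x = u \<or> less_fun x u"
        using that A unfolding Upper_def lex_cube_simps(2) by auto
      show ?thesis
        using least[OF u] lex_cube_less_fun_linear[OF t u(1)] unfolding lex_cube_simps(2) by blast
    qed
  qed (use A t in auto)
  then show ?thesis by blast
qed

text \<open>The infimum is obtained as the supremum of the lower bounds.\<close>

lemma lex_cube_ex_inf:
  assumes A: "A \<subseteq> carrier (lex_cube n)"
  shows "\<exists>s. greatest (lex_cube n) s (Lower (lex_cube n) A)"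
proof -
  have L: "Lower (lex_cube n) A \<subseteq> carrier (lex_cube n)" by (auto simp: Lower_def)
  then obtain s where s: "least (lex_cube n) s (Upper (lex_cube n) (Lower (lex_cube n) A))"
    using lex_cube_ex_sup by blast
  have "s \<sqsubseteq>\<^bsub>lex_cube n\<^esub> a" if "a \<in> A" for a
    using s that A unfolding least_def Upper_def Lower_def by blast
  then have "greatest (lex_cube n) s (Lower (lex_cube n) A)"
    using s L unfolding greatest_def least_def Upper_def Lower_def by blast
  then show ?thesis by blast
qed

text \<open>The supremum operator chooses some least upper bound; existence and antisymmetry make it
  determined.\<close>

lemma lex_cube_sup_eq_iff:
  assumes "A \<subseteq> carrier (lex_cube n)"
  shows "\<Squnion>\<^bsub>lex_cube n\<^esub> A = s \<longleftrightarrow> least (lex_cube n) s (Upper (lex_cube n) A)"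
proof -
  have "least (lex_cube n) (\<Squnion>\<^bsub>lex_cube n\<^esub> A) (Upper (lex_cube n) A)"
    unfolding sup_def using lex_cube_ex_sup[OF assms] by (rule someI_ex)
  moreover have "x = y" if "least (lex_cube n) x U" "least (lex_cube n) y U" for x y U
  proof -
    have "x = y \<or> less_fun x y" "y = x \<or> less_fun y x"
      using that unfolding least_def lex_cube_simps(2) by simp_all
    then show ?thesis using less_fun_asym[of x y] by blast
  qed
  ultimately show ?thesis by blast
qed

lemma lex_cube_inf_eq_iff:
  assumes "A \<subseteq> carrier (lex_cube n)"
  shows "\<Sqinter>\<^bsub>lex_cube n\<^esub> A = s \<longleftrightarrow> greatest (lex_cube n) s (Lower (lex_cube n) A)"
proof -
  have "greatest (lex_cube n) (\<Sqinter>\<^bsub>lex_cube n\<^esub> A) (Lower (lex_cube n) A)"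
    unfolding inf_def using lex_cube_ex_inf[OF assms] by (rule someI_ex)
  moreover have "x = y" if "greatest (lex_cube n) x U" "greatest (lex_cube n) y U" for x y U
  proof -
    have "x = y \<or> less_fun x y" "y = x \<or> less_fun y x"
      using that unfolding greatest_def lex_cube_simps(2) by simp_all
    then show ?thesis using less_fun_asym[of x y] by blast
  qed
  ultimately show ?thesis by blast
qed

lemma lex_point_carrier: "lex_point n \<iota> ` D \<subseteq> carrier (lex_cube n)"
  by (auto simp: lex_point_def lex_cube_simps split: if_splits)

lemma lex_cube_1_le_iff:
  assumes "x \<in> carrier (lex_cube 1)" "y \<in> carrier (lex_cube 1)"
  shows "x \<sqsubseteq>\<^bsub>lex_cube 1\<^esub> y \<longleftrightarrow> x 0 \<le> y 0"
proof -
  have arb: "x k = y k" if "k \<noteq> 0" for k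
    using lex_cube_undefined[OF assms(1), of k] lex_cube_undefined[OF assms(2), of k] that by simp
  have "x = y \<longleftrightarrow> x 0 = y 0"
  proof
    assume "x 0 = y 0"
    then show "x = y" using arb by (intro ext) metis
  qed simp
  moreover have "less_fun x y \<longleftrightarrow> x 0 < y 0"
  proof
    assume "less_fun x y"
    then obtain k where "x k < y k" by (auto elim: less_funE)
    then show "x 0 < y 0" using arb[of k] by (cases "k = 0") auto
  qed (auto intro: less_funI)
  ultimately show ?thesis unfolding lex_cube_simps(2) by auto
qed

section \<open>Transfer between the value group and the cube\<close>

context
  fixes G :: "'g::linordered_ab_group_add set" and n :: nat and \<Gamma> :: "nat \<Rightarrow> real set"
    and \<iota> :: "'g \<Rightarrow> nat \<Rightarrow> real"
  assumes lex: "lex_identification G n \<Gamma> \<iota>"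
begin

text \<open>The first place of difference is below n because the functions
  \<open>\<iota> \<gamma>\<close> are extensional, so cutting down to \<open>{..<n}\<close> keeps
  the comparison.\<close>

lemma lex_point_le_iff:
  assumes "\<alpha> \<in> G" "\<beta> \<in> G"
  shows "lex_point n \<iota> \<alpha> \<sqsubseteq>\<^bsub>lex_cube n\<^esub> lex_point n \<iota> \<beta> \<longleftrightarrow> \<alpha> \<le> \<beta>"
proof -
  have less: "less_fun (lex_point n \<iota> \<alpha>) (lex_point n \<iota> \<beta>)"
    if "\<alpha> < \<beta>" "\<alpha> \<in> G" "\<beta> \<in> G" for \<alpha> \<beta>
  proof -
    have "less_fun (\<iota> \<alpha>) (\<iota> \<beta>)" using lex that unfolding lex_identification_def by blast
    then obtain k where k: "\<iota> \<alpha> k < \<iota> \<beta> k" "\<And>j. j < k \<Longrightarrow> \<iota> \<alpha> j = \<iota> \<beta> j"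
      by (auto elim: less_funE)
    have "\<iota> \<alpha> \<in> Pi\<^sub>E {..<n} \<Gamma>" "\<iota> \<beta> \<in> Pi\<^sub>E {..<n} \<Gamma>"
      using lex that unfolding lex_identification_def bij_betw_def by auto
    then have "k < n" using k(1) PiE_arb[of _ "{..<n}" \<Gamma> k] by (metis less_irrefl lessThan_iff)
    then show ?thesis
      by (intro less_funI exI[of _ k]) (use k in \<open>auto simp: lex_point_def\<close>)
  qed
  show ?thesis
  proof
    assume le: "lex_point n \<iota> \<alpha> \<sqsubseteq>\<^bsub>lex_cube n\<^esub> lex_point n \<iota> \<beta>"
    show "\<alpha> \<le> \<beta>"
    proof (rule ccontr)
      assume "\<not> \<alpha> \<le> \<beta>"
      then have "less_fun (lex_point n \<iota> \<beta>) (lex_point n \<iota> \<alpha>)" using less assms by simp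
      then show False using le less_fun_asym less_fun_irrefl unfolding lex_cube_simps(2) by metis
    qed
  next
    assume "\<alpha> \<le> \<beta>"
    then show "lex_point n \<iota> \<alpha> \<sqsubseteq>\<^bsub>lex_cube n\<^esub> lex_point n \<iota> \<beta>"
      using less[OF _ assms] unfolding lex_cube_simps(2) by (cases "\<alpha> = \<beta>") auto
  qed
qed

text \<open>An element of G below \<open>\<gamma>\<close> that bounded D would give an upper bound
  in the cube below the least one.\<close>

lemma gauge_sup_D:
  assumes "D \<subseteq> G" "gauge_sup n \<iota> D \<in> lex_point n \<iota> ` G"
  obtains \<gamma> where "\<gamma> \<in> G" "\<And>\<delta>. \<delta> \<in> D \<Longrightarrow> \<delta> \<le> \<gamma>"
    "\<And>\<beta>. \<beta> \<in> G \<Longrightarrow> \<beta> < \<gamma> \<Longrightarrow> \<exists>\<delta>\<in>D. \<beta> < \<delta>"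
proof -
  obtain \<gamma> where \<gamma>: "\<gamma> \<in> G" "gauge_sup n \<iota> D = lex_point n \<iota> \<gamma>" using assms(2) by blast
  then have least: "least (lex_cube n) (lex_point n \<iota> \<gamma>) (Upper (lex_cube n) (lex_point n \<iota> ` D))"
    unfolding gauge_sup_def lex_cube_sup_eq_iff[OF lex_point_carrier] by blast
  show ?thesis
  proof (rule that[OF \<gamma>(1)])
    show "\<delta> \<le> \<gamma>" if "\<delta> \<in> D" for \<delta>
      using least_Upper_above[OF least imageI[OF that] lex_point_carrier] lex_point_le_iff[of \<delta> \<gamma>]
        that assms(1) \<gamma>(1) by blast
    show "\<exists>\<delta>\<in>D. \<beta> < \<delta>" if \<beta>: "\<beta> \<in> G" "\<beta> < \<gamma>" for \<beta>
    proof (rule ccontr)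
      assume "\<not> ?thesis"
      then have "lex_point n \<iota> \<delta> \<sqsubseteq>\<^bsub>lex_cube n\<^esub> lex_point n \<iota> \<beta>" if "\<delta> \<in> D" for \<delta>
        using that assms(1) \<beta>(1) by (subst lex_point_le_iff) (auto simp: not_less)
      then have "lex_point n \<iota> \<beta> \<in> Upper (lex_cube n) (lex_point n \<iota> ` D)"
        using lex_point_carrier[of n \<iota> "{\<beta>}"] unfolding Upper_def by auto
      then show False
        using least_le[OF least] lex_point_le_iff[OF \<gamma>(1) \<beta>(1)] \<beta>(2) by auto
    qed
  qed
qed

lemma gauge_inf_D:
  assumes "D \<subseteq> G" "gauge_inf n \<iota> D \<in> lex_point n \<iota> ` G"
  obtains \<gamma> where "\<gamma> \<in> G" "\<And>\<delta>. \<delta> \<in> D \<Longrightarrow> \<gamma> \<le> \<delta>"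
    "\<And>\<beta>. \<beta> \<in> G \<Longrightarrow> \<gamma> < \<beta> \<Longrightarrow> \<exists>\<delta>\<in>D. \<delta> < \<beta>"
proof -
  obtain \<gamma> where \<gamma>: "\<gamma> \<in> G" "gauge_inf n \<iota> D = lex_point n \<iota> \<gamma>" using assms(2) by blast
  then have greatest: "greatest (lex_cube n) (lex_point n \<iota> \<gamma>) (Lower (lex_cube n) (lex_point n \<iota> ` D))"
    unfolding gauge_inf_def lex_cube_inf_eq_iff[OF lex_point_carrier] by blast
  show ?thesis
  proof (rule that[OF \<gamma>(1)])
    show "\<gamma> \<le> \<delta>" if "\<delta> \<in> D" for \<delta>
      using greatest_Lower_below[OF greatest imageI[OF that] lex_point_carrier] lex_point_le_iff[of \<gamma> \<delta>]
        that assms(1) \<gamma>(1) by blast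
    show "\<exists>\<delta>\<in>D. \<delta> < \<beta>" if \<beta>: "\<beta> \<in> G" "\<gamma> < \<beta>" for \<beta>
    proof (rule ccontr)
      assume "\<not> ?thesis"
      then have "lex_point n \<iota> \<beta> \<sqsubseteq>\<^bsub>lex_cube n\<^esub> lex_point n \<iota> \<delta>" if "\<delta> \<in> D" for \<delta>
        using that assms(1) \<beta>(1) by (subst lex_point_le_iff) (auto simp: not_less)
      then have "lex_point n \<iota> \<beta> \<in> Lower (lex_cube n) (lex_point n \<iota> ` D)"
        using lex_point_carrier[of n \<iota> "{\<beta>}"] unfolding Lower_def by auto
      then show False
        using greatest_le[OF greatest] lex_point_le_iff[OF \<beta>(1) \<gamma>(1)] \<beta>(2) by auto
    qed
  qed
qed

end

section \<open>The cube of dimension one\<close>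

context
  fixes G :: "'g::linordered_ab_group_add set" and \<Gamma> :: "nat \<Rightarrow> real set"
    and \<iota> :: "'g \<Rightarrow> nat \<Rightarrow> real"
  assumes lex: "lex_identification G 1 \<Gamma> \<iota>"
begin

lemma lex_identification_1_add: "\<alpha> \<in> G \<Longrightarrow> \<beta> \<in> G \<Longrightarrow> \<iota> (\<alpha> + \<beta>) 0 = \<iota> \<alpha> 0 + \<iota> \<beta> 0"
  using lex unfolding lex_identification_def by auto

lemma lex_identification_1_less:
  assumes "\<alpha> \<in> G" "\<beta> \<in> G"
  shows "\<alpha> < \<beta> \<longleftrightarrow> \<iota> \<alpha> 0 < \<iota> \<beta> 0"
proof -
  have "\<beta> \<le> \<alpha> \<longleftrightarrow> lex_point 1 \<iota> \<beta> 0 \<le> lex_point 1 \<iota> \<alpha> 0"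
    using lex_point_le_iff[OF lex assms(2,1)] lex_point_carrier[of 1 \<iota> UNIV]
    by (subst lex_cube_1_le_iff[symmetric]) auto
  then show ?thesis by (simp add: lex_point_def not_le[symmetric])
qed

text \<open>The upper bounds in the cube range over extended reals: \<open>\<infinity>\<close> is
  trivially large enough, and \<open>-\<infinity>\<close> bounds no nonempty D; finite bounds reduce
  to the real supremum.\<close>

lemma gauge_sup_1_eq:
  assumes "D \<noteq> {}" "bdd_above ((\<lambda>\<delta>. \<iota> \<delta> 0) ` D)" "\<iota> \<gamma> 0 = (SUP \<delta>\<in>D. \<iota> \<delta> 0)"
  shows "gauge_sup 1 \<iota> D = lex_point 1 \<iota> \<gamma>"
  unfolding gauge_sup_def lex_cube_sup_eq_iff[OF lex_point_carrier]
proof (rule least_UpperI)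
  have car: "lex_point 1 \<iota> \<delta> \<in> carrier (lex_cube 1)" for \<delta>
    by (simp add: lex_point_def lex_cube_simps)
  then show "lex_point 1 \<iota> \<gamma> \<in> carrier (lex_cube 1)" .
  show "x \<sqsubseteq>\<^bsub>lex_cube 1\<^esub> lex_point 1 \<iota> \<gamma>" if x: "x \<in> lex_point 1 \<iota> ` D" for x
  proof -
    obtain \<delta> where \<delta>: "\<delta> \<in> D" "x = lex_point 1 \<iota> \<delta>" using x by blast
    have "\<iota> \<delta> 0 \<le> \<iota> \<gamma> 0" unfolding assms(3) by (rule cSUP_upper[OF \<delta>(1) assms(2)])
    then show ?thesis unfolding \<delta>(2) lex_cube_1_le_iff[OF car car] by (simp add: lex_point_def)
  qed
  show "lex_point 1 \<iota> \<gamma> \<sqsubseteq>\<^bsub>lex_cube 1\<^esub> u" if "u \<in> Upper (lex_cube 1) (lex_point 1 \<iota> ` D)" for u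
  proof -
    have u: "u \<in> carrier (lex_cube 1)" using that by (auto simp: Upper_def)
    have le: "ereal (\<iota> \<delta> 0) \<le> u 0" if "\<delta> \<in> D" for \<delta>
    proof -
      have "lex_point 1 \<iota> \<delta> \<sqsubseteq>\<^bsub>lex_cube 1\<^esub> u"
        using \<open>u \<in> Upper _ _\<close> \<open>\<delta> \<in> D\<close> car unfolding Upper_def by blast
      then show ?thesis unfolding lex_cube_1_le_iff[OF car u] by (simp add: lex_point_def)
    qed
    have "ereal (\<iota> \<gamma> 0) \<le> u 0"
    proof (cases "u 0")
      case (real r)
      then have "\<iota> \<gamma> 0 \<le> r" unfolding assms(3) using le by (intro cSUP_least assms(1)) simp
      then show ?thesis using real by simp
    next
      case MInf
      then show ?thesis using le assms(1) by auto
    qed simp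
    then show ?thesis unfolding lex_cube_1_le_iff[OF car u] by (simp add: lex_point_def)
  qed
qed (rule lex_point_carrier)

lemma gauge_inf_1_eq:
  assumes "D \<noteq> {}" "bdd_below ((\<lambda>\<delta>. \<iota> \<delta> 0) ` D)" "\<iota> \<gamma> 0 = (INF \<delta>\<in>D. \<iota> \<delta> 0)"
  shows "gauge_inf 1 \<iota> D = lex_point 1 \<iota> \<gamma>"
  unfolding gauge_inf_def lex_cube_inf_eq_iff[OF lex_point_carrier]
proof (rule greatest_LowerI)
  have car: "lex_point 1 \<iota> \<delta> \<in> carrier (lex_cube 1)" for \<delta>
    by (simp add: lex_point_def lex_cube_simps)
  then show "lex_point 1 \<iota> \<gamma> \<in> carrier (lex_cube 1)" .
  show "lex_point 1 \<iota> \<gamma> \<sqsubseteq>\<^bsub>lex_cube 1\<^esub> x" if x: "x \<in> lex_point 1 \<iota> ` D" for x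
  proof -
    obtain \<delta> where \<delta>: "\<delta> \<in> D" "x = lex_point 1 \<iota> \<delta>" using x by blast
    have "\<iota> \<gamma> 0 \<le> \<iota> \<delta> 0" unfolding assms(3) by (rule cINF_lower[OF assms(2) \<delta>(1)])
    then show ?thesis unfolding \<delta>(2) lex_cube_1_le_iff[OF car car] by (simp add: lex_point_def)
  qed
  show "u \<sqsubseteq>\<^bsub>lex_cube 1\<^esub> lex_point 1 \<iota> \<gamma>" if "u \<in> Lower (lex_cube 1) (lex_point 1 \<iota> ` D)" for u
  proof -
    have u: "u \<in> carrier (lex_cube 1)" using that by (auto simp: Lower_def)
    have le: "u 0 \<le> ereal (\<iota> \<delta> 0)" if "\<delta> \<in> D" for \<delta>
    proof -
      have "u \<sqsubseteq>\<^bsub>lex_cube 1\<^esub> lex_point 1 \<iota> \<delta>"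
        using \<open>u \<in> Lower _ _\<close> \<open>\<delta> \<in> D\<close> car unfolding Lower_def by blast
      then show ?thesis unfolding lex_cube_1_le_iff[OF u car] by (simp add: lex_point_def)
    qed
    have "u 0 \<le> ereal (\<iota> \<gamma> 0)"
    proof (cases "u 0")
      case (real r)
      then have "r \<le> \<iota> \<gamma> 0" unfolding assms(3) using le by (intro cINF_greatest assms(1)) simp
      then show ?thesis using real by simp
    next
      case PInf
      then show ?thesis using le assms(1) by auto
    qed simp
    then show ?thesis unfolding lex_cube_1_le_iff[OF u car] by (simp add: lex_point_def)
  qed
qed (rule lex_point_carrier)

end

section \<open>The rank of \<open>v\<^sub>E\<close>\<close>

text \<open>Serves to place a Cauchy sequence, whose definition does not mention algebraic type, in
  the pseudo convergent case of the hypotheses.\<close>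

lemma pseudo_convergent_not_divergent:
  fixes z :: "'i::{wellorder,no_top} \<Rightarrow> 'k::field"
  assumes "pseudo_convergent v z" "pseudo_divergent v z"
  shows False
proof -
  define i :: 'i where "i = undefined"
  have "v (z i - z (succ_idx i)) < v (z (succ_idx i) - z (succ_idx (succ_idx i)))"
    "v (z (succ_idx i) - z (succ_idx (succ_idx i))) < v (z i - z (succ_idx i))"
    using assms less_succ_idx[of i] less_succ_idx[of "succ_idx i"]
    unfolding pseudo_convergent_def pseudo_divergent_def by blast+
  then show False by simp
qed

context closure_val
begin

text \<open>Differences of terms have the same values in the closure, so the dichotomy holds there
  with the same gauge, for all a in the closure.\<close>

lemma seq_val_pcs:
  assumes E: "is_seq_valuation v z vE" and z: "pcs_algebraic v z"
  shows "seq_val v vbar vE z (pcs_delta v z) 1"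
proof unfold_locales
  show "krull_valuation vE" "valuation_ring vE = seq_ring v z"
    using E by (auto simp: is_seq_valuation_def)
  show "algebraic_type v z" using z by (simp add: pcs_algebraic_def)
  have pcs: "pseudo_convergent v z" using z by (simp add: pcs_algebraic_def)
  have eq: "vbar (to_ac x - to_ac y) = v (x - y)" for x y
    using ext[of "x - y"] by simp
  have pcs': "pseudo_convergent vbar (\<lambda>\<nu>. to_ac (z \<nu>))"
    using pcs unfolding pseudo_convergent_def eq .
  have delta: "pcs_delta vbar (\<lambda>\<nu>. to_ac (z \<nu>)) = pcs_delta v z"
    unfolding pcs_delta_def fval_def eq ..
  show "(\<exists>c\<in>value_group vbar. \<forall>\<^sub>F \<nu> in at_top. vbar (to_ac (z \<nu>) - a) = Fin c) \<or>
      (\<forall>\<^sub>F \<nu> in at_top. vbar (to_ac (z \<nu>) - a) = Fin (imul 1 (pcs_delta v z \<nu>)))" for a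
    using L.pcs_v_minus[OF pcs', of a] unfolding delta by (auto intro: always_eventually)
qed

lemma seq_val_pds:
  fixes z :: "'i::{wellorder,no_top} \<Rightarrow> 'a"
  assumes E: "is_seq_valuation v z vE" and z: "pseudo_divergent v z"
  shows "seq_val v vbar vE z (\<lambda>\<nu>. - pds_delta v z \<nu>) (- 1)"
proof unfold_locales
  show "krull_valuation vE" "valuation_ring vE = seq_ring v z"
    using E by (auto simp: is_seq_valuation_def)
  have eq: "vbar (to_ac x - to_ac y) = v (x - y)" for x y
    using ext[of "x - y"] by simp
  have pds': "pseudo_divergent vbar (\<lambda>\<nu>. to_ac (z \<nu>))"
    using z unfolding pseudo_divergent_def eq .
  have delta: "pds_delta vbar (\<lambda>\<nu>. to_ac (z \<nu>)) = pds_delta v z"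
    unfolding pds_delta_def fval_def eq ..
  show "(\<exists>c\<in>value_group vbar. \<forall>\<^sub>F \<nu> in at_top. vbar (to_ac (z \<nu>) - a) = Fin c) \<or>
      (\<forall>\<^sub>F \<nu> in at_top. vbar (to_ac (z \<nu>) - a) = Fin (imul (- 1) (- pds_delta v z \<nu>)))" for a
    using L.pds_v_minus[OF pds', of a] unfolding delta by simp
  show "algebraic_type v z"
    unfolding algebraic_type_def
  \<comment> \<open>The values of X minus the first term are the gauge, which is strictly decreasing
    from the third index on.\<close>
  proof (intro exI[of _ "[:- z first_idx, 1:]"] notI)
    assume "\<exists>c. \<forall>\<^sub>F \<nu> in at_top. v (poly [:- z first_idx, 1:] (z \<nu>)) = c"
    then obtain c where "\<forall>\<^sub>F \<nu> in at_top. v (z \<nu> - z first_idx) = c" by auto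
    then obtain i where i: "\<And>\<nu>. i \<le> \<nu> \<Longrightarrow> v (z \<nu> - z first_idx) = c"
      by (auto simp: eventually_at_top_linorder)
    \<comment> \<open>Both j and its successor lie beyond i, where the value is constant, and beyond
      the second index, where the gauge is finite and decreasing.\<close>
    define j where "j = succ_idx (max i (succ_idx first_idx))"
    have j: "i \<le> j" "succ_idx first_idx < j" "j < succ_idx j" "i \<le> succ_idx j"
      "succ_idx first_idx < succ_idx j"
      using less_succ_idx[of "max i (succ_idx first_idx)"] less_succ_idx[of j]
      by (auto simp: j_def)
    have first: "first_idx < \<nu>" if "succ_idx first_idx < \<nu>" for \<nu> :: 'i
      using less_succ_idx that by (rule less_trans)
    have "Fin (pds_delta v z j) = Fin (pds_delta v z (succ_idx j))"
      using K.pds_v_diff[OF z j(2) first[OF j(2)]] K.pds_v_diff[OF z j(5) first[OF j(5)]]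
        i[OF j(1)] i[OF j(4)] by simp
    then show False using K.pds_delta_less[OF z j(2,3)] by simp
  qed
qed

lemma has_rank_pcs:
  assumes lex: "lex_identification (value_group vbar) n \<Gamma> \<iota>"
    and z: "pcs_algebraic v z" and E: "is_seq_valuation v z vE"
  shows "has_rank (value_group v) n \<Longrightarrow>
      cauchy_pcs v z \<or> gauge_sup n \<iota> (pcs_gauge v z) \<in> lex_point n \<iota> ` value_group vbar \<Longrightarrow>
      has_rank (value_group vE) (n + 1)"
    and "n = 1 \<Longrightarrow> has_rank (value_group vE) 2 \<Longrightarrow>
      cauchy_pcs v z \<or> gauge_sup n \<iota> (pcs_gauge v z) \<in> lex_point n \<iota> ` value_group vbar"
proof -
  interpret seq_val v vbar vE z "pcs_delta v z" 1 using E z by (rule seq_val_pcs)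
  have pcs: "pseudo_convergent v z" using z by (simp add: pcs_algebraic_def)
  let ?\<delta> = "pcs_delta v z"
  have gauge: "pcs_gauge v z = range ?\<delta>" by (rule K.pcs_gauge_eq[OF pcs])
  have \<delta>_G: "?\<delta> \<nu> \<in> G" for \<nu> using K.pcs_delta_in[OF pcs] value_group_subset by blast
  then have sub: "pcs_gauge v z \<subseteq> G" by (auto simp: gauge)
  have mono: "?\<delta> \<nu> < ?\<delta> \<mu>" if "\<nu> < \<mu>" for \<nu> \<mu> by (rule K.pcs_delta_less[OF pcs that])
  have ev: "\<forall>\<^sub>F \<mu> in at_top. ?\<delta> \<nu> < ?\<delta> \<mu>" for \<nu>
    by (rule eventually_mono[OF eventually_gt_at_top mono])
  show "has_rank (value_group vE) (n + 1)"
    if rank: "has_rank (value_group v) n"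
      and type: "cauchy_pcs v z \<or> gauge_sup n \<iota> (pcs_gauge v z) \<in> lex_point n \<iota> ` G"
    using type
  proof
    assume cauchy: "cauchy_pcs v z"
    show ?thesis
    proof (rule has_rank_Suc_of_cofinal[OF rank])
      fix \<gamma> assume "\<gamma> \<in> value_group v"
      then obtain \<nu> where "\<gamma> \<le> ?\<delta> \<nu>" using cauchy gauge unfolding cauchy_pcs_def by auto
      then show "\<forall>\<^sub>F \<mu> in at_top. \<gamma> < ?\<delta> \<mu>"
        using ev[of \<nu>] by (auto elim: eventually_mono)
    qed
  next
    assume "gauge_sup n \<iota> (pcs_gauge v z) \<in> lex_point n \<iota> ` G"
    then obtain \<gamma> where \<gamma>: "\<gamma> \<in> G" "\<And>\<delta>. \<delta> \<in> pcs_gauge v z \<Longrightarrow> \<delta> \<le> \<gamma>"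
      "\<And>\<beta>. \<beta> \<in> G \<Longrightarrow> \<beta> < \<gamma> \<Longrightarrow> \<exists>\<delta>\<in>pcs_gauge v z. \<beta> < \<delta>"
      using gauge_sup_D[OF lex sub] by metis
    show ?thesis
    proof (rule has_rank_Suc_of_limit[OF rank \<gamma>(1)])
      \<comment> \<open>The bound is strict since the gauge has no largest element.\<close>
      have "?\<delta> \<nu> < \<gamma>" for \<nu>
        using mono[OF less_succ_idx, of \<nu>] \<gamma>(2)[of "?\<delta> (succ_idx \<nu>)"] by (simp add: gauge)
      then show "\<forall>\<^sub>F \<nu> in at_top. ?\<delta> \<nu> < \<gamma>" by simp
      fix h assume h: "h \<in> G" "0 < h"
      have "\<gamma> + - h \<in> G" using h(1) \<gamma>(1) G unfolding add_subgroup_def by blast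
      then obtain \<nu> where "\<gamma> - h < ?\<delta> \<nu>" using \<gamma>(3)[of "\<gamma> - h"] h(2) by (auto simp: gauge)
      then show "\<forall>\<^sub>F \<mu> in at_top. \<gamma> - h < ?\<delta> \<mu>"
        using ev[of \<nu>] by (auto elim: eventually_mono)
    qed
  qed
  show "cauchy_pcs v z \<or> gauge_sup n \<iota> (pcs_gauge v z) \<in> lex_point n \<iota> ` G"
    if n: "n = 1" and rank: "has_rank (value_group vE) 2"
  proof (rule ccontr)
    assume neg: "\<not> ?thesis"
    have lex1: "lex_identification G 1 \<Gamma> \<iota>" using lex n by simp
    note less = lex_identification_1_less[OF lex1]
    \<comment> \<open>Failure of the Cauchy property bounds the gauge by an element of vK, so a real
      supremum s exists; failure of the condition on the supremum then keeps s out of the image of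
      G.\<close>
    obtain \<gamma> where \<gamma>: "\<gamma> \<in> value_group v" "\<And>\<nu>. ?\<delta> \<nu> < \<gamma>"
      using neg pcs unfolding cauchy_pcs_def gauge by (auto simp: not_le)
    have "\<gamma> \<in> G" using \<gamma>(1) value_group_subset by blast
    then have le: "\<iota> (?\<delta> \<nu>) 0 \<le> \<iota> \<gamma> 0" for \<nu> using less[OF \<delta>_G] \<gamma>(2) by (simp add: less_imp_le)
    then have bdd: "bdd_above ((\<lambda>\<delta>. \<iota> \<delta> 0) ` pcs_gauge v z)"
      unfolding gauge by (intro bdd_aboveI[of _ "\<iota> \<gamma> 0"]) auto
    define s where "s = (SUP \<delta>\<in>pcs_gauge v z. \<iota> \<delta> 0)"
    have ne: "pcs_gauge v z \<noteq> {}" by (simp add: gauge)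
    have "\<not> has_rank (value_group vE) 2"
    proof (rule not_has_rank_2[of "\<lambda>\<gamma>. \<iota> \<gamma> 0"])
      show "\<forall>\<^sub>F \<nu> in at_top. ?\<delta> \<nu> \<in> G" using \<delta>_G by simp
      show "((\<lambda>\<nu>. \<iota> (?\<delta> \<nu>) 0) \<longlongrightarrow> s) at_top"
      proof (rule order_tendstoI)
        fix a assume "a < s"
        then obtain \<nu> where \<nu>: "a < \<iota> (?\<delta> \<nu>) 0"
          unfolding s_def using less_cSUP_iff[OF ne bdd] by (auto simp: gauge)
        show "\<forall>\<^sub>F \<mu> in at_top. a < \<iota> (?\<delta> \<mu>) 0"
          using ev[of \<nu>]
        proof eventually_elim
          case (elim \<mu>)
          then show ?case using less[OF \<delta>_G \<delta>_G] \<nu> by (meson less_trans)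
        qed
      next
        fix a assume "s < a"
        moreover have "\<iota> (?\<delta> \<nu>) 0 \<le> s" for \<nu>
          unfolding s_def using bdd by (intro cSUP_upper) (auto simp: gauge)
        ultimately show "\<forall>\<^sub>F \<nu> in at_top. \<iota> (?\<delta> \<nu>) 0 < a"
          by (intro always_eventually allI) (rule le_less_trans)
      qed
      show "s \<notin> (\<lambda>\<gamma>. \<iota> \<gamma> 0) ` G"
      proof
        assume "s \<in> (\<lambda>\<gamma>. \<iota> \<gamma> 0) ` G"
        then obtain \<beta> where \<beta>: "\<beta> \<in> G" "\<iota> \<beta> 0 = s" by blast
        then have "gauge_sup 1 \<iota> (pcs_gauge v z) = lex_point 1 \<iota> \<beta>"
          using gauge_sup_1_eq[OF lex1 ne bdd] by (simp add: s_def)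
        then show False using neg n \<beta>(1) by blast
      qed
    qed (use less lex_identification_1_add[OF lex1] in auto)
    then show False using rank by blast
  qed
qed

lemma has_rank_pds:
  fixes z :: "'i::{wellorder,no_top} \<Rightarrow> 'a"
  assumes lex: "lex_identification (value_group vbar) n \<Gamma> \<iota>"
    and z: "pseudo_divergent v z" and E: "is_seq_valuation v z vE"
  shows "has_rank (value_group v) n \<Longrightarrow>
      diverges_to_infinity v z \<or> gauge_inf n \<iota> (pds_gauge v z) \<in> lex_point n \<iota> ` value_group vbar \<Longrightarrow>
      has_rank (value_group vE) (n + 1)"
    and "n = 1 \<Longrightarrow> has_rank (value_group vE) 2 \<Longrightarrow>
      diverges_to_infinity v z \<or> gauge_inf n \<iota> (pds_gauge v z) \<in> lex_point n \<iota> ` value_group vbar"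
proof -
  interpret seq_val v vbar vE z "\<lambda>\<nu>. - pds_delta v z \<nu>" "- 1" using E z by (rule seq_val_pds)
  let ?\<delta> = "pds_delta v z" and ?i = "succ_idx first_idx :: 'i"
  have \<delta>_gauge: "?\<delta> \<nu> \<in> pds_gauge v z" "?\<delta> \<nu> \<in> G" if "?i < \<nu>" for \<nu>
    using K.pds_delta_in_gauge[OF z that] value_group_subset by blast+
  have sub: "pds_gauge v z \<subseteq> G"
    unfolding pds_gauge_def value_group_def using ext by (auto simp del: to_ac_diff) metis
  have ev: "\<forall>\<^sub>F \<mu> in at_top. ?i < \<mu> \<and> ?\<delta> \<mu> < ?\<delta> \<nu>" if "?i < \<nu>" for \<nu>
    by (rule eventually_mono[OF eventually_gt_at_top[of \<nu>]])
      (use that in \<open>auto intro: K.pds_delta_less[OF z]\<close>)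
  have ev_less: "\<forall>\<^sub>F \<mu> in at_top. ?i < \<mu> \<and> ?\<delta> \<mu> < \<delta>" if \<delta>: "\<delta> \<in> pds_gauge v z" for \<delta>
  proof -
    obtain \<nu> where \<nu>: "?i < \<nu>" "?\<delta> \<nu> < \<delta>" using K.pds_gauge_greater[OF z \<delta>] by blast
    show ?thesis using ev[OF \<nu>(1)] by eventually_elim (use \<nu>(2) in auto)
  qed
  show "has_rank (value_group vE) (n + 1)"
    if rank: "has_rank (value_group v) n"
      and type: "diverges_to_infinity v z \<or> gauge_inf n \<iota> (pds_gauge v z) \<in> lex_point n \<iota> ` G"
    using type
  proof
    assume div: "diverges_to_infinity v z"
    show ?thesis
    proof (rule has_rank_Suc_of_cofinal[OF rank])
      fix \<gamma> assume "\<gamma> \<in> value_group v"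
      then have "- \<gamma> \<in> value_group v" using V unfolding add_subgroup_def by blast
      then obtain \<delta> where \<delta>: "\<delta> \<in> pds_gauge v z" "\<delta> \<le> - \<gamma>"
        using div unfolding diverges_to_infinity_def by blast
      show "\<forall>\<^sub>F \<mu> in at_top. \<gamma> < - ?\<delta> \<mu>"
        using ev_less[OF \<delta>(1)]
      proof eventually_elim
        case (elim \<mu>)
        then have "?\<delta> \<mu> < - \<gamma>" using \<delta>(2) by (meson less_le_trans)
        then show ?case by (simp add: less_minus_iff)
      qed
    qed
  next
    assume "gauge_inf n \<iota> (pds_gauge v z) \<in> lex_point n \<iota> ` G"
    then obtain \<gamma> where \<gamma>: "\<gamma> \<in> G" "\<And>\<delta>. \<delta> \<in> pds_gauge v z \<Longrightarrow> \<gamma> \<le> \<delta>"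
      "\<And>\<beta>. \<beta> \<in> G \<Longrightarrow> \<gamma> < \<beta> \<Longrightarrow> \<exists>\<delta>\<in>pds_gauge v z. \<delta> < \<beta>"
      using gauge_inf_D[OF lex sub] by metis
    show ?thesis
    proof (rule has_rank_Suc_of_limit[OF rank])
      show "- \<gamma> \<in> G" using \<gamma>(1) G unfolding add_subgroup_def by blast
      have "\<gamma> < ?\<delta> \<nu>" if \<nu>: "?i < \<nu>" for \<nu>
      proof -
        have "?i < succ_idx \<nu>" using \<nu> less_succ_idx by (rule less_trans)
        then have "\<gamma> \<le> ?\<delta> (succ_idx \<nu>)" by (intro \<gamma>(2) \<delta>_gauge)
        also have "\<dots> < ?\<delta> \<nu>" by (rule K.pds_delta_less[OF z \<nu> less_succ_idx])
        finally show ?thesis .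
      qed
      then show "\<forall>\<^sub>F \<nu> in at_top. - ?\<delta> \<nu> < - \<gamma>"
        by (intro eventually_mono[OF eventually_gt_at_top[of ?i]]) simp
      fix h assume h: "h \<in> G" "0 < h"
      have "\<gamma> + h \<in> G" using h(1) \<gamma>(1) G unfolding add_subgroup_def by blast
      then obtain \<delta> where \<delta>: "\<delta> \<in> pds_gauge v z" "\<delta> < \<gamma> + h" using \<gamma>(3)[of "\<gamma> + h"] h(2) by auto
      show "\<forall>\<^sub>F \<mu> in at_top. - \<gamma> - h < - ?\<delta> \<mu>"
        using ev_less[OF \<delta>(1)]
      proof eventually_elim
        case (elim \<mu>)
        then have "?\<delta> \<mu> < \<gamma> + h" using \<delta>(2) by (meson less_trans)
        then have "- (\<gamma> + h) < - ?\<delta> \<mu>" by (simp only: neg_less_iff_less)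
        then show ?case by (simp add: algebra_simps)
      qed
    qed
  qed
  show "diverges_to_infinity v z \<or> gauge_inf n \<iota> (pds_gauge v z) \<in> lex_point n \<iota> ` G"
    if n: "n = 1" and rank: "has_rank (value_group vE) 2"
  proof (rule ccontr)
    assume neg: "\<not> ?thesis"
    have lex1: "lex_identification G 1 \<Gamma> \<iota>" using lex n by simp
    note less = lex_identification_1_less[OF lex1]
    note add = lex_identification_1_add[OF lex1]
    have G_uminus: "- \<alpha> \<in> G" if "\<alpha> \<in> G" for \<alpha> using that G unfolding add_subgroup_def by blast
    have uminus: "\<iota> (- \<alpha>) 0 = - \<iota> \<alpha> 0" if "\<alpha> \<in> G" for \<alpha>
    proof -
      have "\<iota> 0 0 = 0" using add[of 0 0] G by (simp add: add_subgroup_def)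
      then show ?thesis using add[OF that G_uminus[OF that]] by simp
    qed
    obtain \<gamma> where \<gamma>: "\<gamma> \<in> value_group v" "\<And>\<delta>. \<delta> \<in> pds_gauge v z \<Longrightarrow> \<gamma> < \<delta>"
      using neg z unfolding diverges_to_infinity_def by (auto simp: not_le)
    have "\<gamma> \<in> G" using \<gamma>(1) value_group_subset by blast
    then have le: "\<iota> \<gamma> 0 \<le> \<iota> \<delta> 0" if "\<delta> \<in> pds_gauge v z" for \<delta>
      using less[of \<gamma> \<delta>] \<gamma>(2)[OF that] that sub by (auto simp: less_imp_le)
    then have bdd: "bdd_below ((\<lambda>\<delta>. \<iota> \<delta> 0) ` pds_gauge v z)"
      by (intro bdd_belowI[of _ "\<iota> \<gamma> 0"]) auto
    define s where "s = (INF \<delta>\<in>pds_gauge v z. \<iota> \<delta> 0)"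
    have ne: "pds_gauge v z \<noteq> {}" using \<delta>_gauge(1)[OF less_succ_idx] by blast
    have evi: "\<forall>\<^sub>F \<nu> in at_top. ?i < \<nu>" by (rule eventually_gt_at_top)
    have "\<not> has_rank (value_group vE) 2"
    proof (rule not_has_rank_2[of "\<lambda>\<gamma>. \<iota> \<gamma> 0"])
      show "\<forall>\<^sub>F \<nu> in at_top. - ?\<delta> \<nu> \<in> G"
        using evi by eventually_elim (intro G_uminus \<delta>_gauge)
      \<comment> \<open>Since \<open>\<epsilon>\<close> is the negative gauge, the limit is minus
        the real infimum; a preimage of -s in G would yield one of s by negation.\<close>
      show "((\<lambda>\<nu>. \<iota> (- ?\<delta> \<nu>) 0) \<longlongrightarrow> - s) at_top"
      proof (rule order_tendstoI)
        fix a assume "a < - s"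
        then have "s < - a" by simp
        then obtain \<delta> where \<delta>: "\<delta> \<in> pds_gauge v z" "\<iota> \<delta> 0 < - a"
          unfolding s_def using cINF_less_iff[OF ne bdd] by blast
        show "\<forall>\<^sub>F \<mu> in at_top. a < \<iota> (- ?\<delta> \<mu>) 0"
          using ev_less[OF \<delta>(1)]
        proof eventually_elim
          case (elim \<mu>)
          then have \<mu>: "?\<delta> \<mu> \<in> G" "\<iota> (?\<delta> \<mu>) 0 < \<iota> \<delta> 0"
            using \<delta>_gauge(2)[of \<mu>] less[of "?\<delta> \<mu>" \<delta>] \<delta>(1) sub by auto
          then show ?case using \<delta>(2) uminus[OF \<mu>(1)] by simp
        qed
      next
        fix a assume "- s < a"
        show "\<forall>\<^sub>F \<nu> in at_top. \<iota> (- ?\<delta> \<nu>) 0 < a"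
          using evi
        proof eventually_elim
          case (elim \<nu>)
          have "s \<le> \<iota> (?\<delta> \<nu>) 0"
            unfolding s_def by (rule cINF_lower[OF bdd \<delta>_gauge(1)[OF elim]])
          then show ?case using uminus[OF \<delta>_gauge(2)[OF elim]] \<open>- s < a\<close> by simp
        qed
      qed
      show "- s \<notin> (\<lambda>\<gamma>. \<iota> \<gamma> 0) ` G"
      proof
        assume "- s \<in> (\<lambda>\<gamma>. \<iota> \<gamma> 0) ` G"
        then obtain \<beta> where \<beta>: "\<beta> \<in> G" "\<iota> \<beta> 0 = - s" by force
        then have "\<iota> (- \<beta>) 0 = s" using uminus by simp
        then have "gauge_inf 1 \<iota> (pds_gauge v z) = lex_point 1 \<iota> (- \<beta>)"
          using gauge_inf_1_eq[OF lex1 ne bdd] by (simp add: s_def)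
        then show False using neg n G_uminus[OF \<beta>(1)] by blast
      qed
    qed (use less add in auto)
    then show False using rank by blast
  qed
qed

end

theorem theorem9p3:
  fixes v :: "'a::field \<Rightarrow> 'g::linordered_ab_group_add extended"
    and vbar :: "'a alg_closure \<Rightarrow> 'g extended"
    and z :: "'i::{wellorder,no_top} \<Rightarrow> 'a"
    and vE :: "'a poly fract \<Rightarrow> 'h::linordered_ab_group_add extended"
    and n :: nat and \<Gamma> :: "nat \<Rightarrow> real set" and \<iota> :: "'g \<Rightarrow> nat \<Rightarrow> real"
  assumes "krull_valuation v" and "has_rank (value_group v) n"
    and "krull_valuation vbar" and "\<And>x. vbar (to_ac x) = v x"
    and "lex_identification (value_group vbar) n \<Gamma> \<iota>"
    and "pcs_algebraic v z \<or> pseudo_divergent v z"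
    and "is_seq_valuation v z vE"
  shows "(rank_jump_type v (value_group vbar) n \<iota> z \<longrightarrow> has_rank (value_group vE) (n + 1)) \<and>
         (n = 1 \<and> has_rank (value_group vE) (n + 1) \<longrightarrow> rank_jump_type v (value_group vbar) n \<iota> z)"
proof -
  interpret closure_val v vbar using assms(1,3,4) by unfold_locales
  note pcs = has_rank_pcs[OF assms(5) _ assms(7)] and pds = has_rank_pds[OF assms(5) _ assms(7)]
  have cauchy: "pcs_algebraic v z" if "cauchy_pcs v z"
    using that assms(6) pseudo_convergent_not_divergent[of v z] unfolding cauchy_pcs_def by blast
  have "has_rank (value_group vE) (n + 1)" if "rank_jump_type v (value_group vbar) n \<iota> z"
    using that cauchy pcs(1)[OF _ assms(2)] pds(1)[OF _ assms(2)]
    unfolding rank_jump_type_def diverges_to_infinity_def[of v z] by blast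
  moreover have "rank_jump_type v (value_group vbar) n \<iota> z"
    if n: "n = 1" and rank: "has_rank (value_group vE) (n + 1)"
  proof -
    have "has_rank (value_group vE) 2" using rank n by (simp add: numeral_2_eq_2)
    then show ?thesis
      using assms(6) pcs(2)[OF _ n] pds(2)[OF _ n] unfolding rank_jump_type_def by blast
  qed
  ultimately show ?thesis by blast
qed

end
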